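(* Let $n\ge 3$ be an integer, $0<m<\frac{n-2}{n}$, $\rho_1>0$, $\eta>0$, $\beta>\frac{m\rho_1}{n-2-nm}$ and $\alpha=\frac{2\beta+\rho_1}{1-m}$. Then there exists a unique function $f\in C^2((0,\infty))$ satisfying $$\left(\frac{f^m}{m}\right)_{rr}+\frac{n-1}{r}\left(\frac{f^m}{m}\right)_r+\alpha f+\beta r f_r=0,\qquad f>0,\qquad\text{in }(0,\infty)$$ and $$\lim_{r\to 0^+}r^{\alpha/\beta}f(r)=\eta.$$
   Context: Subscripts $r$ denote differentiation with respect to $r$. The equation is the radial form of $\Delta(f^m/m)+\alpha f+\beta x\cdot\nabla f=0$, $f>0$, in $\mathbb{R}^n\setminus\{0\}$. *)

theory Defs
  imports "HOL-Analysis.Analysis"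
begin

(* f is of class C^2 on S; meant for open S, so that the two-sided derivative "deriv f"
   depends only on the values of f on S. *)
definition C2_on :: "real set \<Rightarrow> (real \<Rightarrow> real) \<Rightarrow> bool" where
  "C2_on S f \<longleftrightarrow> f differentiable_on S \<and> deriv f C1_differentiable_on S"

definition radial_eq :: "nat \<Rightarrow> real \<Rightarrow> real \<Rightarrow> real \<Rightarrow> (real \<Rightarrow> real) \<Rightarrow> real \<Rightarrow> bool" where
  "radial_eq n m \<alpha> \<beta> f r \<longleftrightarrow>
     deriv (deriv (\<lambda>s. f s powr m / m)) r
       + (real n - 1) / r * deriv (\<lambda>s. f s powr m / m) r
       + \<alpha> * f r + \<beta> * r * deriv f r = 0"

end

theory Submission
  imports Defs
begin

text \<open>
Put \<open>k = \<alpha> / \<beta>\<close>. The conditions on \<open>\<beta>\<close> and \<open>\<rho>\<^sub>1\<close> say exactly that \<open>2 / (1 - m) < k < (n - 2) / m\<close>. The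
solution is to behave like \<open>\<eta> r powr (- k)\<close> at the origin, and the lower bound on \<open>k\<close> means that there
the drift \<open>\<alpha> f + \<beta> r f'\<close> dominates the diffusion: the equation is singular at \<open>0\<close>, effectively of
first order, so one number \<open>\<eta>\<close> selects one solution. With \<open>\<delta> = k - k m - 2 = \<rho>\<^sub>1 / \<beta> > 0\<close>, the
substitution \<open>f r = r powr (- k) * V (r powr \<delta>) powr (1 / m)\<close> turns the problem (lemma \<open>radial_eq_iff\<close>)
into

  \<open>s^2 V'' + (c V + b s) V' = A V\<close>,  \<open>V(0+) = \<eta> powr m > 0\<close>,

with \<open>c x = (\<beta> / \<delta>) x powr (1 / m - 1)\<close> positive and increasing. The upper bound on \<open>k\<close> gives
\<open>A \<ge> 0\<close>, which forces \<open>V\<close> to be nondecreasing, so \<open>V\<close> stays away from \<open>0\<close> on the whole half-line.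

The point \<open>s = 0\<close> is an irregular singularity: near it the homogeneous equation
\<open>s^2 y' + (c V + b s) y = 0\<close> for \<open>y = V'\<close> has solutions growing like \<open>exp (c / s)\<close>. Such growth is
incompatible with a limit of \<open>V\<close>. Excluding it yields a comparison principle without an initial
condition for \<open>y\<close> (lemma \<open>singular_comparison\<close>), and everything else follows from this principle with
multiples of \<open>exp (L s)\<close> as barriers, \<open>L\<close> being so large that \<open>L s^2 + b s + c(V(0+))\<close> is bounded below
by a positive constant.

Freezing the coefficient \<open>c V\<close> and the right-hand side at a given function \<open>u\<close> leaves a linear problem
that is solved by integration from \<open>0\<close> (lemma \<open>frozen_solution_exists\<close>). On every bounded interval
the solution operator is a contraction with factor \<open>1 / 2\<close> in a norm weighted by \<open>exp (- L s)\<close> (lemma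
\<open>contraction_weight_exists\<close>). Picard iteration started from a constant therefore converges on the whole
half-line (lemma \<open>solution_exists\<close>), all iterates being defined there and satisfying the same
exponential bounds. Conversely, comparison gives every positive solution the bounds under
which the contraction acts (lemma \<open>solution_in_strip\<close>), and so two solutions coincide (lemma
\<open>solution_unique\<close>).
\<close>

section \<open>Integration from the origin and comparison\<close>

lemma limit_at_0_le_of_deriv_nonneg:
  fixes f f' :: "real \<Rightarrow> real"
  assumes deriv: "\<And>s. 0 < s \<Longrightarrow> s < S \<Longrightarrow> (f has_real_derivative f' s) (at s)"
    and nonneg: "\<And>s. 0 < s \<Longrightarrow> s < S \<Longrightarrow> 0 \<le> f' s"
    and lim: "(f \<longlongrightarrow> l) (at_right 0)"
    and s: "0 < s" "s < S"
  shows "l \<le> f s"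
proof (rule tendsto_upperbound[OF lim])
  have "f t \<le> f s" if "0 < t" "t < s" for t
    by (rule DERIV_nonneg_imp_nondecreasing) (use that s deriv nonneg in \<open>force+\<close>)
  then show "\<forall>\<^sub>F t in at_right 0. f t \<le> f s"
    using s(1) by (auto simp: eventually_at_right_field)
qed simp

text \<open>
Integration from \<open>0\<close> of a nonnegative function that may be unbounded there. A majorant \<open>P'\<close> with a
nonnegative antiderivative replaces an integrability condition: any antiderivative \<open>F\<close> of \<open>q\<close> increases
while \<open>F - P\<close> decreases, so \<open>F\<close> is bounded below and its infimum is its limit at \<open>0\<close>. The bound by \<open>P\<close>
comes for free.
\<close>

lemma antiderivative_vanishing_at_0:
  fixes q P P' :: "real \<Rightarrow> real"
  assumes cont: "continuous_on {0<..} q" and q: "\<And>s. 0 < s \<Longrightarrow> 0 \<le> q s"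
    and P: "\<And>s. 0 < s \<Longrightarrow> (P has_real_derivative P' s) (at s)" "\<And>s. 0 < s \<Longrightarrow> 0 \<le> P s"
    and qP: "\<And>s. 0 < s \<Longrightarrow> q s \<le> P' s"
  obtains Q where "\<And>s. 0 < s \<Longrightarrow> (Q has_real_derivative q s) (at s)"
    "\<And>s. 0 < s \<Longrightarrow> 0 \<le> Q s" "\<And>s. 0 < s \<Longrightarrow> Q s \<le> P s" "(Q \<longlongrightarrow> 0) (at_right 0)"
proof -
  have "\<exists>F. \<forall>x::real. ereal 0 < ereal x \<longrightarrow> ereal x < \<infinity> \<longrightarrow> (F has_vector_derivative q x) (at x)"
    by (rule einterval_antiderivative)
       (use cont in \<open>auto simp: continuous_on_eq_continuous_at open_greaterThan\<close>)
  then obtain F where F: "\<And>x. 0 < x \<Longrightarrow> (F has_real_derivative q x) (at x)"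
    by (auto simp: has_real_derivative_iff_has_vector_derivative)
  have mono: "F s \<le> F t" if "0 < s" "s \<le> t" for s t
    by (rule deriv_nonneg_imp_mono[of s t F q]) (use that F q in auto)
  have anti: "P s - F s \<le> P t - F t" if "0 < s" "s \<le> t" for s t
  proof (rule DERIV_nonneg_imp_nondecreasing[OF that(2)])
    fix x assume "s \<le> x" "x \<le> t"
    then have "((\<lambda>x. P x - F x) has_real_derivative P' x - q x) (at x)" "0 \<le> P' x - q x"
      using F P qP[of x] that by (auto intro!: derivative_intros)
    then show "\<exists>y. ((\<lambda>x. P x - F x) has_real_derivative y) (at x) \<and> 0 \<le> y" by blast
  qed
  have low: "F 1 - P 1 \<le> F s" if "0 < s" for s
    using anti[of s 1] mono[of 1 s] P(2)[OF that] P(2)[of 1] that by (cases "s \<le> 1") auto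
  define l where "l = Inf (F ` {0<..})"
  have bdd: "bdd_below (F ` {0<..})" by (rule bdd_belowI2) (use low in auto)
  have l: "l \<le> F s" if "0 < s" for s unfolding l_def by (rule cInf_lower) (use that bdd in auto)
  have approx: "\<exists>s>0. F s < l + e" if "0 < e" for e
    using cInf_lessD[of "F ` {0<..}" "l + e"] that by (auto simp: l_def)
  show thesis
  proof (rule that[of "\<lambda>s. F s - l"])
    show "((\<lambda>s. F s - l) has_real_derivative q s) (at s)" if "0 < s" for s
      using F[OF that] by (auto intro!: derivative_eq_intros)
    show "0 \<le> F s - l" if "0 < s" for s using l[OF that] by simp
    show "F s - l \<le> P s" if s: "0 < s" for s
    proof (rule field_le_epsilon)
      fix e :: real assume "0 < e"
      then obtain t where t: "0 < t" "F t < l + e" using approx by blast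
      define t' where "t' = min s t"
      have t': "0 < t'" "t' \<le> s" "t' \<le> t" using s t by (auto simp: t'_def)
      have "F s - P s \<le> F t'" using anti[OF t'(1,2)] P(2)[OF t'(1)] by simp
      also have "\<dots> \<le> F t" by (rule mono[OF t'(1,3)])
      finally show "F s - l \<le> P s + e" using t by simp
    qed
    show "((\<lambda>s. F s - l) \<longlongrightarrow> 0) (at_right 0)"
    proof (rule tendstoI)
      fix e :: real assume "0 < e"
      then obtain t where t: "0 < t" "F t < l + e" using approx by blast
      have "dist (F s - l) 0 < e" if "0 < s" "s < t" for s
        using mono[of s t] l[of s] t that by (auto simp: dist_real_def)
      then show "\<forall>\<^sub>F s in at_right 0. dist (F s - l) 0 < e"
        using t(1) by (auto simp: eventually_at_right_field)
    qed
  qed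
qed

text \<open>
If \<open>H\<close> is an antiderivative of \<open>h / s^2\<close>, the inequality says that \<open>exp H * D\<close> is nondecreasing. Since
\<open>h\<close> is at least \<open>\<kappa> > 0\<close> near \<open>0\<close>, \<open>exp H\<close> vanishes there faster than any power of \<open>s\<close>; the proof
extracts quadratic decay. A negative value of \<open>D\<close> would thus make \<open>D\<close> go to minus infinity at least
as fast as a multiple of \<open>- 1 / s^2\<close>. A lower bound for \<open>s * D s\<close> along one sequence going to \<open>0\<close>
excludes this; such a sequence is what the mean value theorem provides for the derivative of a bounded
function.
\<close>

lemma singular_comparison:
  fixes D D' h :: "real \<Rightarrow> real"
  assumes deriv: "\<And>s. 0 < s \<Longrightarrow> s < S \<Longrightarrow> (D has_real_derivative D' s) (at s)"
    and ineq: "\<And>s. 0 < s \<Longrightarrow> s < S \<Longrightarrow> 0 \<le> s\<^sup>2 * D' s + h s * D s"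
    and cont: "continuous_on {0<..<S} h"
    and pos: "0 < \<kappa>" "\<forall>\<^sub>F s in at_right 0. \<kappa> \<le> h s"
    and freq: "\<exists>\<^sub>F s in at_right 0. - C \<le> s * D s"
    and s: "0 < s" "s < S"
  shows "0 \<le> D s"
proof (rule ccontr)
  assume neg: "\<not> 0 \<le> D s"
  have "\<exists>F. \<forall>x::real. ereal 0 < ereal x \<longrightarrow> ereal x < ereal S \<longrightarrow> (F has_vector_derivative h x / x\<^sup>2) (at x)"
    by (rule einterval_antiderivative)
       (use cont s in \<open>auto simp: continuous_on_eq_continuous_at intro!: continuous_intros\<close>)
  then obtain H where H: "\<And>x. 0 < x \<Longrightarrow> x < S \<Longrightarrow> (H has_real_derivative h x / x\<^sup>2) (at x)"
    by (auto simp: has_real_derivative_iff_has_vector_derivative)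
  \<comment> \<open>\<open>exp H\<close> is the integrating factor of the differential inequality\<close>
  have mono: "exp (H x) * D x \<le> exp (H s) * D s" if x: "0 < x" "x \<le> s" for x
  proof (rule DERIV_nonneg_imp_nondecreasing[OF x(2)])
    fix z assume z: "x \<le> z" "z \<le> s"
    then have z0: "0 < z" "z < S" using x s by auto
    have "((\<lambda>z. exp (H z) * D z) has_real_derivative exp (H z) / z\<^sup>2 * (z\<^sup>2 * D' z + h z * D z)) (at z)"
      using z0 by (auto intro!: derivative_eq_intros H deriv simp: field_simps)
    moreover have "0 \<le> exp (H z) / z\<^sup>2 * (z\<^sup>2 * D' z + h z * D z)"
      using ineq[OF z0] by auto
    ultimately show "\<exists>y. ((\<lambda>z. exp (H z) * D z) has_real_derivative y) (at z) \<and> 0 \<le> y" by blast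
  qed
  obtain s1 where s1: "0 < s1" "\<And>x. 0 < x \<Longrightarrow> x < s1 \<Longrightarrow> \<kappa> \<le> h x"
    using pos(2) by (auto simp: eventually_at_right_field)
  define s2 where "s2 = min (min (s1/2) (\<kappa>/2)) (s/2)"
  have s2: "0 < s2" "s2 < s1" "s2 \<le> \<kappa>/2" "s2 < s" using s1(1) pos(1) s by (auto simp: s2_def min_def)
  \<comment> \<open>the choice of \<open>s2\<close> makes \<open>H' = h / x^2\<close> at least \<open>2 / x\<close> there, which gives the quadratic decay of \<open>exp H\<close>\<close>
  have Hbd: "H x - 2 * ln x \<le> H s2 - 2 * ln s2" if x: "0 < x" "x \<le> s2" for x
  proof (rule DERIV_nonneg_imp_nondecreasing[OF x(2)])
    fix z assume z: "x \<le> z" "z \<le> s2"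
    then have z0: "0 < z" "z < S" "z < s1" "2 * z \<le> \<kappa>" using x s s2 by auto
    have "((\<lambda>z. H z - 2 * ln z) has_real_derivative h z / z\<^sup>2 - 2 / z) (at z)"
      using z0 by (auto intro!: derivative_eq_intros H simp: field_simps)
    moreover have "0 \<le> h z / z\<^sup>2 - 2 / z"
      using s1(2)[OF z0(1,3)] z0 by (auto simp: field_simps power2_eq_square)
    ultimately show "\<exists>y. ((\<lambda>z. H z - 2 * ln z) has_real_derivative y) (at z) \<and> 0 \<le> y" by blast
  qed
  define g where "g = - (exp (H s) * D s)"
  define K where "K = exp (H s2 - 2 * ln s2)"
  have g: "0 < g" using neg by (simp add: g_def mult_pos_neg)
  have K: "0 < K" by (simp add: K_def)
  have expH: "exp (H x) \<le> K * x\<^sup>2" if x: "0 < x" "x \<le> s2" for x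
  proof -
    have "exp (H x) \<le> exp (H s2 - 2 * ln s2 + 2 * ln x)" using Hbd[OF x] by simp
    also have "\<dots> = K * (exp (ln x))\<^sup>2" by (simp add: K_def exp_add exp_double)
    finally show ?thesis using x by simp
  qed
  have small: "s2 \<le> x \<or> g \<le> K * C * x" if x: "0 < x" "- C \<le> x * D x" for x
  proof (rule disjCI)
    assume "\<not> g \<le> K * C * x"
    show "s2 \<le> x"
    proof (rule ccontr)
      assume "\<not> s2 \<le> x"
      then have xs: "x \<le> s2" "x \<le> s" using s2 by auto
      have 1: "g \<le> exp (H x) * (- D x)" using mono[OF x(1) xs(2)] by (simp add: g_def)
      then have Dneg: "0 \<le> - D x" using g by (smt (verit) exp_gt_zero mult_pos_neg)
      have "g \<le> K * x\<^sup>2 * (- D x)"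
        using 1 mult_right_mono[OF expH[OF x(1) xs(1)] Dneg] by linarith
      also have "\<dots> = K * x * (- (x * D x))" by (simp add: power2_eq_square)
      also have "\<dots> \<le> K * x * C" by (rule mult_left_mono) (use x K in auto)
      finally show False using \<open>\<not> g \<le> K * C * x\<close> by (simp add: ac_simps)
    qed
  qed
  have "((\<lambda>x. K * C * x) \<longlongrightarrow> K * C * 0) (at_right 0)" by (intro tendsto_intros)
  then have "\<forall>\<^sub>F x in at_right 0. K * C * x < g" using g by (simp add: order_tendsto_iff)
  moreover have "\<forall>\<^sub>F x in at_right 0. 0 < x \<and> x < s2" using s2(1) by (auto simp: eventually_at_right_field)
  ultimately have "\<forall>\<^sub>F x in at_right 0. \<not> (- C \<le> x * D x)"
    by eventually_elim (use small in force)
  with freq show False by (auto simp: frequently_def)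
qed

section \<open>A nonlinear equation with an irregular singularity\<close>

text \<open>
Completing the square, with half of \<open>c\<close> left over.
\<close>

lemma quadratic_lower_bound:
  fixes L b c s :: real
  assumes "0 < c" "b\<^sup>2 / (2 * c) \<le> L"
  shows "c / 2 \<le> L * s\<^sup>2 + b * s + c"
proof -
  have "0 \<le> (b * s + c)\<^sup>2 / (2 * c)" using assms by simp
  also have "\<dots> = b\<^sup>2 / (2 * c) * s\<^sup>2 + b * s + c / 2"
    using assms by (simp add: field_simps power2_eq_square)
  also have "\<dots> \<le> L * s\<^sup>2 + b * s + c / 2"
    using mult_right_mono[OF assms(2), of "s\<^sup>2"] by simp
  finally show ?thesis by simp
qed

text \<open>
The monotonicity of \<open>c\<close> lets the single value \<open>c v0\<close> bound the coefficient from below along every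
function that is at least \<open>v0\<close>.
\<close>

locale singular_ode =
  fixes c :: "real \<Rightarrow> real" and A b v0 :: real
  assumes A_nonneg: "0 \<le> A" and v0_pos: "0 < v0"
    and c_cont: "continuous_on {0<..} c"
    and c_pos: "\<And>x. 0 < x \<Longrightarrow> 0 < c x"
    and c_mono: "\<And>x y. 0 < x \<Longrightarrow> x \<le> y \<Longrightarrow> c x \<le> c y"
    and c_lipschitz: "\<And>V. \<exists>K\<ge>0. \<forall>x\<in>{v0..V}. \<forall>y\<in>{v0..V}. \<bar>c x - c y\<bar> \<le> K * \<bar>x - y\<bar>"
begin

text \<open>
The equation \<open>s^2 v'' + (c u + b s) v' = A u\<close> with \<open>v(0+) = v0\<close>, as a first-order system for \<open>v\<close> and
\<open>y = v'\<close>. The solutions of the nonlinear problem are the fixed points, \<open>u = v\<close>.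
\<close>

definition frozen_solution :: "real \<Rightarrow> (real \<Rightarrow> real) \<Rightarrow> (real \<Rightarrow> real) \<Rightarrow> (real \<Rightarrow> real) \<Rightarrow> bool" where
  "frozen_solution S u v y \<longleftrightarrow>
     (\<forall>s. 0 < s \<longrightarrow> s < S \<longrightarrow> (v has_real_derivative y s) (at s)
        \<and> (y has_real_derivative (A * u s - (c (u s) + b * s) * y s) / s\<^sup>2) (at s))
     \<and> (v \<longlongrightarrow> v0) (at_right 0)"

lemma frozen_solutionD:
  assumes "frozen_solution S u v y" "0 < s" "s < S"
  shows "(v has_real_derivative y s) (at s)"
    "(y has_real_derivative (A * u s - (c (u s) + b * s) * y s) / s\<^sup>2) (at s)"
  using assms unfolding frozen_solution_def by auto

lemma coeff_lower_bound:
  assumes "b\<^sup>2 / (2 * c v0) \<le> L" "v0 \<le> x"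
  shows "c v0 / 2 \<le> L * s\<^sup>2 + (c x + b * s)"
  using quadratic_lower_bound[OF c_pos[OF v0_pos] assms(1), of s] c_mono[OF v0_pos assms(2)] by simp

lemma coeff_continuous:
  assumes "continuous_on {0<..<S} u" "\<And>s. 0 < s \<Longrightarrow> s < S \<Longrightarrow> 0 < u s"
  shows "continuous_on {0<..<S} (\<lambda>s. c (u s) + b * s)"
  by (intro continuous_intros continuous_on_compose2[OF c_cont assms(1)]) (use assms(2) in auto)

lemma coeff_eventually_pos:
  assumes "\<forall>\<^sub>F s in at_right 0. v0 / 2 \<le> u s"
  shows "\<forall>\<^sub>F s in at_right 0. c (v0 / 2) / 2 \<le> c (u s) + b * s"
proof -
  have p: "0 < c (v0 / 2)" using c_pos v0_pos by simp
  \<comment> \<open>\<open>b\<close> may be negative, but \<open>b * s\<close> is small near \<open>0\<close>\<close>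
  have "((\<lambda>s. b * s) \<longlongrightarrow> b * 0) (at_right 0)" by (intro tendsto_intros)
  then have "\<forall>\<^sub>F s in at_right 0. - (c (v0 / 2) / 2) < b * s"
    using p by (intro order_tendstoD(1)) auto
  with assms show ?thesis
  proof eventually_elim
    case (elim s)
    then show ?case using c_mono[of "v0/2" "u s"] v0_pos by auto
  qed
qed

lemma frozen_comparison:
  assumes deriv: "\<And>s. 0 < s \<Longrightarrow> s < S \<Longrightarrow> (D has_real_derivative D' s) (at s)"
    and ineq: "\<And>s. 0 < s \<Longrightarrow> s < S \<Longrightarrow> 0 \<le> s\<^sup>2 * D' s + (c (u s) + b * s) * D s"
    and u: "continuous_on {0<..<S} u" "\<And>s. 0 < s \<Longrightarrow> s < S \<Longrightarrow> 0 < u s"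
      "\<forall>\<^sub>F s in at_right 0. v0 / 2 \<le> u s"
    and freq: "\<exists>\<^sub>F s in at_right 0. - C \<le> s * D s"
    and s: "0 < s" "s < S"
  shows "0 \<le> D s"
  by (rule singular_comparison[OF deriv ineq coeff_continuous[OF u(1,2)] _ coeff_eventually_pos[OF u(3)] freq s])
     (use c_pos v0_pos in auto)

text \<open>
The class of functions between \<open>v0\<close> and \<open>v0 * exp (L * s)\<close> is invariant under \<open>u \<mapsto> v\<close>, because
\<open>Y = L * v0 * exp (L * s)\<close> is a supersolution of the equation for \<open>y\<close>. The same \<open>Y\<close> supplies the
majorants for the two integrations from \<open>0\<close>: \<open>exp H * Y\<close> for \<open>exp H * y\<close>, and its own
antiderivative for \<open>v - v0\<close>.
\<close>

lemma frozen_solution_exists: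
  assumes L: "b\<^sup>2 / (2 * c v0) \<le> L" "2 * A / c v0 \<le> L"
    and u: "continuous_on {0<..} u" "\<And>s. 0 < s \<Longrightarrow> v0 \<le> u s" "\<And>s. 0 < s \<Longrightarrow> u s \<le> v0 * exp (L * s)"
  obtains v y where "\<And>S. frozen_solution S u v y"
    "\<And>s. 0 < s \<Longrightarrow> v0 \<le> v s" "\<And>s. 0 < s \<Longrightarrow> v s \<le> v0 * exp (L * s)"
    "\<And>s. 0 < s \<Longrightarrow> 0 \<le> y s" "\<And>s. 0 < s \<Longrightarrow> y s \<le> L * v0 * exp (L * s)"
proof -
  have c0: "0 < c v0" using c_pos v0_pos by simp
  have upos: "0 < u s" if "0 < s" for s using u(2)[OF that] v0_pos by simp
  have L0: "0 \<le> L" using L(2) A_nonneg c0 by (smt (verit) divide_nonneg_pos)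
  define h where "h = (\<lambda>s. c (u s) + b * s)"
  have hcont: "continuous_on {0<..} h" unfolding h_def
    by (intro continuous_intros continuous_on_compose2[OF c_cont u(1)]) (use upos in auto)
  have "\<exists>F. \<forall>x::real. ereal 0 < ereal x \<longrightarrow> ereal x < \<infinity> \<longrightarrow> (F has_vector_derivative h x / x\<^sup>2) (at x)"
    by (rule einterval_antiderivative)
       (use hcont in \<open>auto simp: continuous_on_eq_continuous_at intro!: continuous_intros\<close>)
  then obtain H where H: "\<And>x. 0 < x \<Longrightarrow> (H has_real_derivative h x / x\<^sup>2) (at x)"
    by (auto simp: has_real_derivative_iff_has_vector_derivative)
  have Hcont: "continuous_on {0<..} H"
    by (rule DERIV_continuous_on, rule has_field_derivative_at_within) (use H in auto)
  define Y where "Y = (\<lambda>s. L * v0 * exp (L * s))"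
  \<comment> \<open>a supersolution of the equation for y\<close>
  have super: "A * u s \<le> Y s * (L * s\<^sup>2 + h s)" if "0 < s" for s
  proof -
    have "A * u s \<le> A * (v0 * exp (L * s))" using u(3)[OF that] A_nonneg by (rule mult_left_mono)
    also have "\<dots> \<le> (L * (c v0 / 2)) * (v0 * exp (L * s))"
      using L(2) c0 v0_pos by (intro mult_right_mono) (auto simp: field_simps)
    also have "\<dots> = Y s * (c v0 / 2)" by (simp add: Y_def)
    also have "\<dots> \<le> Y s * (L * s\<^sup>2 + h s)"
      using coeff_lower_bound[OF L(1) u(2)[OF that]] L0 v0_pos unfolding h_def
      by (intro mult_left_mono) (auto simp: Y_def)
    finally show ?thesis .
  qed
  obtain Q where Q: "\<And>s. 0 < s \<Longrightarrow> (Q has_real_derivative exp (H s) * (A * u s) / s\<^sup>2) (at s)"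
    "\<And>s. 0 < s \<Longrightarrow> 0 \<le> Q s" "\<And>s. 0 < s \<Longrightarrow> Q s \<le> exp (H s) * Y s"
  proof (rule antiderivative_vanishing_at_0[of "\<lambda>s. exp (H s) * (A * u s) / s\<^sup>2" "\<lambda>s. exp (H s) * Y s"
        "\<lambda>s. exp (H s) * (Y s * (L * s\<^sup>2 + h s)) / s\<^sup>2"])
    show "continuous_on {0<..} (\<lambda>s. exp (H s) * (A * u s) / s\<^sup>2)"
      by (intro continuous_intros Hcont u) auto
    show "0 \<le> exp (H s) * (A * u s) / s\<^sup>2" if "0 < s" for s
      using upos[OF that] A_nonneg by simp
    show "((\<lambda>s. exp (H s) * Y s) has_real_derivative exp (H s) * (Y s * (L * s\<^sup>2 + h s)) / s\<^sup>2) (at s)"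
      if "0 < s" for s
      using that unfolding Y_def by (auto intro!: derivative_eq_intros H simp: field_simps)
    show "0 \<le> exp (H s) * Y s" for s using L0 v0_pos by (simp add: Y_def)
    show "exp (H s) * (A * u s) / s\<^sup>2 \<le> exp (H s) * (Y s * (L * s\<^sup>2 + h s)) / s\<^sup>2" if "0 < s" for s
      using super[OF that] by (intro divide_right_mono mult_left_mono) auto
  qed auto
  define y where "y = (\<lambda>s. exp (- H s) * Q s)"
  have y: "(y has_real_derivative (A * u s - h s * y s) / s\<^sup>2) (at s)" if "0 < s" for s
    using that unfolding y_def
    by (auto intro!: derivative_eq_intros H Q(1) simp: field_simps exp_minus)
  have y_nonneg: "0 \<le> y s" if "0 < s" for s using Q(2)[OF that] by (simp add: y_def)
  have y_le: "y s \<le> Y s" if "0 < s" for s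
    using Q(3)[OF that] by (simp add: y_def exp_minus field_simps)
  have ycont: "continuous_on {0<..} y"
    by (rule DERIV_continuous_on, rule has_field_derivative_at_within) (use y in auto)
  obtain w where w: "\<And>s. 0 < s \<Longrightarrow> (w has_real_derivative y s) (at s)"
    "\<And>s. 0 < s \<Longrightarrow> 0 \<le> w s" "\<And>s. 0 < s \<Longrightarrow> w s \<le> v0 * (exp (L * s) - 1)" "(w \<longlongrightarrow> 0) (at_right 0)"
  proof (rule antiderivative_vanishing_at_0[OF ycont y_nonneg, of "\<lambda>s. v0 * (exp (L * s) - 1)" Y])
    show "((\<lambda>s. v0 * (exp (L * s) - 1)) has_real_derivative Y s) (at s)" for s
      unfolding Y_def by (auto intro!: derivative_eq_intros)
    show "0 \<le> v0 * (exp (L * s) - 1)" if "0 < s" for s using that L0 v0_pos by simp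
  qed (use y_le in auto)
  have "frozen_solution S u (\<lambda>s. v0 + w s) y" for S
    unfolding frozen_solution_def
    using w y tendsto_add[OF tendsto_const w(4), of v0]
    by (auto intro!: derivative_eq_intros simp: h_def)
  then show thesis
    by (rule that) (use w(2,3) y_nonneg y_le in \<open>auto simp: Y_def field_simps\<close>)
qed

text \<open>
The difference of \<open>y1\<close> and \<open>y2\<close> satisfies the equation with the coefficient frozen at \<open>u1\<close> and with
right-hand side \<open>A * (u1 - u2) - (c u1 - c u2) * y2\<close>, at most \<open>(A + K * M) * \<bar>u1 - u2\<bar>\<close>. The barrier
\<open>L * D / 2 * exp (L * s)\<close> dominates it once \<open>L\<close> is large. Integrating the barrier divides it by \<open>L\<close>,
which leaves the factor \<open>1 / 2\<close>.
\<close>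

lemma frozen_solution_contraction_one_sided:
  assumes K: "0 \<le> K" "\<And>x y. v0 \<le> x \<Longrightarrow> x \<le> V \<Longrightarrow> v0 \<le> y \<Longrightarrow> y \<le> V \<Longrightarrow> \<bar>c x - c y\<bar> \<le> K * \<bar>x - y\<bar>"
    and L: "b\<^sup>2 / (2 * c v0) \<le> L" "4 * (A + K * M) / c v0 \<le> L"
    and sol: "frozen_solution S u1 v1 y1" "frozen_solution S u2 v2 y2"
    and u1: "continuous_on {0<..<S} u1" "\<And>s. 0 < s \<Longrightarrow> s < S \<Longrightarrow> v0 \<le> u1 s" "\<And>s. 0 < s \<Longrightarrow> s < S \<Longrightarrow> u1 s \<le> V"
    and u2: "\<And>s. 0 < s \<Longrightarrow> s < S \<Longrightarrow> v0 \<le> u2 s" "\<And>s. 0 < s \<Longrightarrow> s < S \<Longrightarrow> u2 s \<le> V"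
    and y1: "\<And>s. 0 < s \<Longrightarrow> s < S \<Longrightarrow> 0 \<le> y1 s" "\<And>s. 0 < s \<Longrightarrow> s < S \<Longrightarrow> y1 s \<le> M"
    and y2: "\<And>s. 0 < s \<Longrightarrow> s < S \<Longrightarrow> 0 \<le> y2 s" "\<And>s. 0 < s \<Longrightarrow> s < S \<Longrightarrow> y2 s \<le> M"
    and diff: "\<And>s. 0 < s \<Longrightarrow> s < S \<Longrightarrow> \<bar>u1 s - u2 s\<bar> \<le> D * exp (L * s)"
    and s: "0 < s" "s < S"
  shows "v1 s - v2 s \<le> D / 2 * exp (L * s)"
proof -
  have c0: "0 < c v0" using c_pos v0_pos by simp
  have M: "0 \<le> M" using y1[OF s] by simp
  have L0: "0 \<le> L" using L(2) A_nonneg c0 K(1) M by (smt (verit) divide_nonneg_pos mult_nonneg_nonneg)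
  have D: "0 \<le> D" using diff[OF s] by (smt (verit) exp_gt_zero mult_neg_pos)
  define E where "E = (\<lambda>s. L * D / 2 * exp (L * s))"
  have "y1 t - y2 t \<le> E t" if t: "0 < t" "t < S" for t
  proof -
    have "0 \<le> E t - (y1 t - y2 t)"
    proof (rule frozen_comparison[where D = "\<lambda>s. E s - (y1 s - y2 s)" and S = S and u = u1])
      fix s assume s: "0 < s" "s < S"
      let ?D' = "L * E s - ((A * u1 s - (c (u1 s) + b * s) * y1 s) / s\<^sup>2
        - (A * u2 s - (c (u2 s) + b * s) * y2 s) / s\<^sup>2)"
      show "((\<lambda>s. E s - (y1 s - y2 s)) has_real_derivative ?D') (at s)"
        unfolding E_def
        by (auto intro!: derivative_eq_intros frozen_solutionD(2)[OF sol(1) s] frozen_solutionD(2)[OF sol(2) s])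
      have "\<bar>(c (u1 s) - c (u2 s)) * y2 s\<bar> \<le> (K * \<bar>u1 s - u2 s\<bar>) * M"
        unfolding abs_mult using K u1 u2 y2 s by (intro mult_mono) auto
      moreover have "A * (u1 s - u2 s) \<le> A * \<bar>u1 s - u2 s\<bar>" using A_nonneg by (intro mult_left_mono) auto
      ultimately have "A * (u1 s - u2 s) - (c (u1 s) - c (u2 s)) * y2 s \<le> (A + K * M) * \<bar>u1 s - u2 s\<bar>"
        by (simp add: algebra_simps abs_le_iff)
      also have "\<dots> \<le> (A + K * M) * (D * exp (L * s))"
        using diff[OF s] A_nonneg K(1) M by (intro mult_left_mono) auto
      also have "\<dots> \<le> (L * (c v0 / 4)) * (D * exp (L * s))"
        using L(2) c0 D by (intro mult_right_mono) (auto simp: field_simps)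
      also have "\<dots> = E s * (c v0 / 2)" by (simp add: E_def)
      also have "\<dots> \<le> E s * (L * s\<^sup>2 + (c (u1 s) + b * s))"
        using coeff_lower_bound[OF L(1) u1(2)[OF s]] L0 D by (intro mult_left_mono) (auto simp: E_def)
      finally have "0 \<le> E s * (L * s\<^sup>2 + (c (u1 s) + b * s))
          - (A * (u1 s - u2 s) - (c (u1 s) - c (u2 s)) * y2 s)" by simp
      also have "\<dots> = s\<^sup>2 * ?D' + (c (u1 s) + b * s) * (E s - (y1 s - y2 s))"
        using s(1) by (simp add: field_simps)
      finally show "0 \<le> s\<^sup>2 * ?D' + (c (u1 s) + b * s) * (E s - (y1 s - y2 s))" .
      show "0 < u1 s" using u1(2)[OF s] v0_pos by simp
    next
      show "\<forall>\<^sub>F s in at_right 0. v0 / 2 \<le> u1 s"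
        using u1(2) v0_pos s by (force simp: eventually_at_right_field intro!: exI[of _ S])
      have "\<forall>\<^sub>F s in at_right 0. - (S * M) \<le> s * (E s - (y1 s - y2 s))"
      proof -
        have "- (S * M) \<le> s * (E s - (y1 s - y2 s))" if s: "0 < s" "s < S" for s
        proof -
          have "s * (y1 s - y2 s) \<le> s * M" using y1[OF s] y2[OF s] s by (intro mult_left_mono) auto
          also have "\<dots> \<le> S * M" using s M by (intro mult_right_mono) auto
          finally have "s * (y1 s - y2 s) \<le> S * M" .
          moreover have "0 \<le> s * E s" using s L0 D by (simp add: E_def)
          ultimately show ?thesis by (simp add: right_diff_distrib)
        qed
        then show ?thesis using s by (force simp: eventually_at_right_field intro!: exI[of _ S])
      qed
      then show "\<exists>\<^sub>F s in at_right 0. - (S * M) \<le> s * (E s - (y1 s - y2 s))"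
        by (rule eventually_frequently[rotated]) simp
    qed (use u1(1) t in auto)
    then show ?thesis by simp
  qed
  note yE = this
  have "D / 2 * exp (L * 0) - (v0 - v0) \<le> D / 2 * exp (L * s) - (v1 s - v2 s)"
  proof (rule limit_at_0_le_of_deriv_nonneg[where S = S and s = s
        and f = "\<lambda>s. D / 2 * exp (L * s) - (v1 s - v2 s)" and f' = "\<lambda>s. E s - (y1 s - y2 s)"])
    fix s assume s: "0 < s" "s < S"
    show "((\<lambda>s. D / 2 * exp (L * s) - (v1 s - v2 s)) has_real_derivative E s - (y1 s - y2 s)) (at s)"
      unfolding E_def
      by (auto intro!: derivative_eq_intros frozen_solutionD(1)[OF sol(1) s] frozen_solutionD(1)[OF sol(2) s])
    show "0 \<le> E s - (y1 s - y2 s)" using yE[OF s] by simp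
  next
    have "(v1 \<longlongrightarrow> v0) (at_right 0)" "(v2 \<longlongrightarrow> v0) (at_right 0)"
      using sol by (auto simp: frozen_solution_def)
    then show "((\<lambda>s. D / 2 * exp (L * s) - (v1 s - v2 s)) \<longlongrightarrow> D / 2 * exp (L * 0) - (v0 - v0)) (at_right 0)"
      by (intro tendsto_intros)
  qed (use s in auto)
  with D show ?thesis by simp
qed

section \<open>Contraction, existence and uniqueness\<close>

definition in_strip :: "real \<Rightarrow> real \<Rightarrow> real \<Rightarrow> (real \<Rightarrow> real) \<Rightarrow> (real \<Rightarrow> real) \<Rightarrow> bool" where
  "in_strip S V M u y \<longleftrightarrow> continuous_on {0<..<S} u
     \<and> (\<forall>s. 0 < s \<longrightarrow> s < S \<longrightarrow> v0 \<le> u s \<and> u s \<le> V \<and> 0 \<le> y s \<and> y s \<le> M)"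

text \<open>
On \<open>(0, S)\<close> the map \<open>u \<mapsto> v\<close> halves distances measured with the weight \<open>exp (- L * s)\<close>, as long as the
functions stay in the strip given by \<open>V\<close> and \<open>M\<close>.
\<close>

definition contraction_weight :: "real \<Rightarrow> real \<Rightarrow> real \<Rightarrow> real \<Rightarrow> bool" where
  "contraction_weight S V M L \<longleftrightarrow> 0 \<le> L \<and>
     (\<forall>u1 v1 y1 u2 v2 y2 D.
        frozen_solution S u1 v1 y1 \<longrightarrow> frozen_solution S u2 v2 y2 \<longrightarrow>
        in_strip S V M u1 y1 \<longrightarrow> in_strip S V M u2 y2 \<longrightarrow>
        (\<forall>s. 0 < s \<longrightarrow> s < S \<longrightarrow> \<bar>u1 s - u2 s\<bar> \<le> D * exp (L * s)) \<longrightarrow>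
        (\<forall>s. 0 < s \<longrightarrow> s < S \<longrightarrow> \<bar>v1 s - v2 s\<bar> \<le> D / 2 * exp (L * s)))"

lemma contraction_weightD:
  assumes "contraction_weight S V M L"
    and "frozen_solution S u1 v1 y1" "frozen_solution S u2 v2 y2"
    and "in_strip S V M u1 y1" "in_strip S V M u2 y2"
    and "\<And>s. 0 < s \<Longrightarrow> s < S \<Longrightarrow> \<bar>u1 s - u2 s\<bar> \<le> D * exp (L * s)"
    and "0 < s" "s < S"
  shows "\<bar>v1 s - v2 s\<bar> \<le> D / 2 * exp (L * s)"
  using assms unfolding contraction_weight_def by blast

lemma contraction_weight_exists:
  assumes "0 \<le> M"
  shows "\<exists>L. contraction_weight S V M L"
proof -
  obtain K where K: "0 \<le> K" "\<forall>x\<in>{v0..V}. \<forall>y\<in>{v0..V}. \<bar>c x - c y\<bar> \<le> K * \<bar>x - y\<bar>"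
    using c_lipschitz by blast
  define L where "L = max (b\<^sup>2 / (2 * c v0)) (4 * (A + K * M) / c v0)"
  have L: "b\<^sup>2 / (2 * c v0) \<le> L" "4 * (A + K * M) / c v0 \<le> L" by (auto simp: L_def)
  show ?thesis
    unfolding contraction_weight_def
  proof (rule exI[of _ L], intro conjI allI impI)
    have "0 < c v0" using c_pos v0_pos by simp
    then show "0 \<le> L" using L(1) by (smt (verit) divide_nonneg_pos zero_le_power2)
  next
    fix u1 v1 y1 u2 v2 y2 D s
    assume *: "frozen_solution S u1 v1 y1" "frozen_solution S u2 v2 y2"
       "in_strip S V M u1 y1" "in_strip S V M u2 y2"
       "\<forall>s. 0 < s \<longrightarrow> s < S \<longrightarrow> \<bar>u1 s - u2 s\<bar> \<le> D * exp (L * s)" "0 < s" "s < S"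
    have "v1 s - v2 s \<le> D / 2 * exp (L * s)"
      by (rule frozen_solution_contraction_one_sided[OF K(1) _ L *(1,2)])
         (use * K in \<open>auto simp: in_strip_def\<close>)
    moreover have "v2 s - v1 s \<le> D / 2 * exp (L * s)"
      by (rule frozen_solution_contraction_one_sided[OF K(1) _ L *(2,1)])
         (use * K in \<open>auto simp: in_strip_def abs_minus_commute\<close>)
    ultimately show "\<bar>v1 s - v2 s\<bar> \<le> D / 2 * exp (L * s)" by linarith
  qed
qed

text \<open>
The iterates \<open>w n\<close> are defined on the whole half-line and lie in one invariant class \<open>X\<close>. The weight
depends on the interval \<open>(0, S)\<close>, so convergence is uniform on each such interval separately, while the
limit is a single function.
\<close>

lemma solution_exists:
  obtains v y where "\<And>S. frozen_solution S v v y" "\<And>s. 0 < s \<Longrightarrow> v0 \<le> v s"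
proof -
  define L where "L = max (b\<^sup>2 / (2 * c v0)) (2 * A / c v0)"
  have c0: "0 < c v0" using c_pos v0_pos by simp
  have L: "b\<^sup>2 / (2 * c v0) \<le> L" "2 * A / c v0 \<le> L" by (auto simp: L_def)
  have L0: "0 \<le> L" using L(2) A_nonneg c0 by (smt (verit) divide_nonneg_pos)
  define X where "X = (\<lambda>v y. continuous_on {0<..} v \<and>
    (\<forall>s>0. v0 \<le> v s \<and> v s \<le> v0 * exp (L * s) \<and> 0 \<le> y s \<and> y s \<le> L * v0 * exp (L * s)))"
  have step: "\<exists>v' y'. X v' y' \<and> (\<forall>S. frozen_solution S v v' y')" if "X v y" for v y
  proof -
    have v: "continuous_on {0<..} v" "\<And>s. 0 < s \<Longrightarrow> v0 \<le> v s"
      "\<And>s. 0 < s \<Longrightarrow> v s \<le> v0 * exp (L * s)" using that by (auto simp: X_def)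
    show ?thesis
    proof (rule frozen_solution_exists[OF L v])
      fix v' y'
      assume *: "\<And>S. frozen_solution S v v' y'"
        "\<And>s. 0 < s \<Longrightarrow> v0 \<le> v' s" "\<And>s. 0 < s \<Longrightarrow> v' s \<le> v0 * exp (L * s)"
        "\<And>s. 0 < s \<Longrightarrow> 0 \<le> y' s" "\<And>s. 0 < s \<Longrightarrow> y' s \<le> L * v0 * exp (L * s)"
      have dv': "(v' has_real_derivative y' s) (at s)" if "0 < s" for s
        using frozen_solutionD(1)[OF *(1)[of "s + 1"]] that by auto
      have "continuous_on {0<..} v'"
        by (rule DERIV_continuous_on[where D = y'], rule has_field_derivative_at_within) (use dv' in auto)
      with * show ?thesis unfolding X_def by blast
    qed
  qed
  have "\<exists>f. \<forall>n. X (fst (f n)) (snd (f n)) \<and>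
      (\<forall>S. frozen_solution S (fst (f n)) (fst (f (Suc n))) (snd (f (Suc n))))"
  proof (rule dependent_nat_choice)
    have "X (\<lambda>s. v0) (\<lambda>s. 0)" using v0_pos L0 by (auto simp: X_def)
    then show "\<exists>p. X (fst p) (snd p)" by (intro exI[of _ "(\<lambda>s. v0, \<lambda>s. 0)"]) simp
  qed (use step in force)
  then obtain f where f: "\<And>n. X (fst (f n)) (snd (f n))"
    "\<And>n S. frozen_solution S (fst (f n)) (fst (f (Suc n))) (snd (f (Suc n)))" by blast
  define w where "w = (\<lambda>n. fst (f n))"
  define z where "z = (\<lambda>n. snd (f n))"
  have X: "X (w n) (z n)" and sol: "frozen_solution S (w n) (w (Suc n)) (z (Suc n))" for n S
    using f by (auto simp: w_def z_def)
  define V where "V = (\<lambda>S. v0 * exp (L * S))"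
  have V0: "0 < V S" for S using v0_pos by (simp add: V_def)
  have strip: "in_strip S (V S) (L * V S) u y" "in_strip S (V S) (L * V S) u y'" if "X u y" "X u y'" for u y y' S
  proof -
    have "v0 * exp (L * s) \<le> V S" "L * v0 * exp (L * s) \<le> L * V S" if "s < S" for s
      using that L0 v0_pos by (auto simp: V_def mult.assoc intro!: mult_left_mono)
    then show "in_strip S (V S) (L * V S) u y" "in_strip S (V S) (L * V S) u y'"
      using that unfolding X_def in_strip_def
      by (auto intro: continuous_on_subset intro: order_trans)
  qed
  have XX: "X u y'" if "X u y" "X u' y'" for u y u' y' using that by (auto simp: X_def)
  define v where "v = (\<lambda>s. w 0 s + (\<Sum>i. w (Suc i) s - w i s))"
  have lim: "uniform_limit {0<..<S} w v sequentially" for S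
  proof -
    have "0 \<le> L * V S" using L0 V0[of S] by simp
    then obtain N where N: "contraction_weight S (V S) (L * V S) N" and N0: "0 \<le> N"
      using contraction_weight_exists[of "L * V S" S "V S"] by (auto simp: contraction_weight_def)
    have bound: "\<bar>w (Suc n) s - w n s\<bar> \<le> V S * (1/2)^n * exp (N * s)" if "0 < s" "s < S" for n s
      using that
    proof (induction n arbitrary: s)
      case 0
      have "v0 \<le> w n s \<and> w n s \<le> V S" for n
        using strip(1)[OF X X, of S n] 0 by (auto simp: in_strip_def)
      from this[of 0] this[of "Suc 0"] have "\<bar>w (Suc 0) s - w 0 s\<bar> \<le> V S * 1"
        using v0_pos by linarith
      also have "\<dots> \<le> V S * exp (N * s)" using 0 V0[of S] N0 by (intro mult_left_mono) auto
      finally show ?case by simp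
    next
      case (Suc n)
      have "\<bar>w (Suc (Suc n)) s - w (Suc n) s\<bar> \<le> (V S * (1/2)^n) / 2 * exp (N * s)"
        by (rule contraction_weightD[OF N sol sol])
           (use Suc XX[OF X X] in \<open>auto intro!: strip(1)\<close>)
      then show ?case by simp
    qed
    have "uniform_limit {0<..<S} (\<lambda>n s. \<Sum>i<n. w (Suc i) s - w i s) (\<lambda>s. \<Sum>i. w (Suc i) s - w i s) sequentially"
    proof (rule Weierstrass_m_test)
      fix n s assume s: "s \<in> {0<..<S}"
      have "\<bar>w (Suc n) s - w n s\<bar> \<le> V S * (1/2)^n * exp (N * s)" using bound s by auto
      also have "\<dots> \<le> V S * (1/2)^n * exp (N * S)"
        using s N0 V0[of S] by (intro mult_left_mono) (auto intro!: mult_left_mono)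
      finally show "norm (w (Suc n) s - w n s) \<le> V S * (1/2)^n * exp (N * S)" by simp
    next
      show "summable (\<lambda>n. V S * (1/2)^n * exp (N * S))"
        by (intro summable_mult summable_mult2 summable_geometric) simp
    qed
    then have "uniform_limit {0<..<S} (\<lambda>n s. w 0 s + (\<Sum>i<n. w (Suc i) s - w i s)) v sequentially"
      unfolding v_def by (intro uniform_limit_intros)
    then show ?thesis by (simp add: sum_lessThan_telescope[of "\<lambda>i. w i s" for s])
  qed
  have ptlim: "(\<lambda>n. w n s) \<longlonglongrightarrow> v s" if "0 < s" for s
    by (rule tendsto_uniform_limitI[OF lim[of "s + 1"]]) (use that in auto)
  have contv: "continuous_on {0<..<S} v" for S
  proof (rule uniform_limit_theorem[OF _ lim])
    have "continuous_on {0<..<S} (w n)" for n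
      by (rule continuous_on_subset[of "{0<..}"]) (use X in \<open>auto simp: X_def\<close>)
    then show "\<forall>\<^sub>F n in sequentially. continuous_on {0<..<S} (w n)" by simp
  qed simp
  have "continuous_on {0<..} v"
  proof (rule open_greaterThan[THEN continuous_on_eq_continuous_at, THEN iffD2], safe)
    fix x :: real assume "0 < x"
    then show "isCont v x"
      using contv[of "x + 1"] by (auto simp: continuous_on_eq_continuous_at)
  qed
  moreover have "v0 \<le> v s" "v s \<le> v0 * exp (L * s)" if "0 < s" for s
    using X that by (auto simp: X_def intro!: LIMSEQ_le_const[OF ptlim] LIMSEQ_le_const2[OF ptlim])
  ultimately have Xv: "X v (\<lambda>s. 0)" using L0 v0_pos by (auto simp: X_def)
  \<comment> \<open>by the contraction, \<open>w (Suc n)\<close> also tends to the image \<open>v'\<close> of \<open>v\<close>; hence \<open>v\<close> is a fixed point, and it inherits the equation from being an image\<close>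
  obtain v' y' where v': "X v' y'" "\<And>S. frozen_solution S v v' y'" using step[OF Xv] by blast
  have eq: "v' s = v s" if s: "0 < s" for s
  proof -
    define S where "S = s + 1"
    have S: "s < S" by (simp add: S_def)
    have "0 \<le> L * V S" using L0 V0[of S] by simp
    then obtain N where N: "contraction_weight S (V S) (L * V S) N" and N0: "0 \<le> N"
      using contraction_weight_exists[of "L * V S" S "V S"] by (auto simp: contraction_weight_def)
    have "(\<lambda>n. w (Suc n) s) \<longlonglongrightarrow> v' s"
    proof (rule tendstoI)
      fix e :: real assume e: "0 < e"
      define d where "d = e * exp (- (N * s))"
      have d: "0 < d" using e by (simp add: d_def)
      have "\<forall>\<^sub>F n in sequentially. \<forall>t\<in>{0<..<S}. dist (w n t) (v t) < d"
        using uniform_limitD[OF lim d] .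
      then show "\<forall>\<^sub>F n in sequentially. dist (w (Suc n) s) (v' s) < e"
      proof eventually_elim
        case (elim n)
        have "\<bar>w (Suc n) s - v' s\<bar> \<le> d / 2 * exp (N * s)"
        proof (rule contraction_weightD[OF N sol v'(2)])
          fix t assume t: "0 < t" "t < S"
          have "\<bar>w n t - v t\<bar> \<le> d * 1" using elim t by (auto simp: dist_real_def intro: less_imp_le)
          also have "\<dots> \<le> d * exp (N * t)" using d t N0 by (intro mult_left_mono) auto
          finally show "\<bar>w n t - v t\<bar> \<le> d * exp (N * t)" .
        qed (use s S XX[OF X X] XX[OF Xv v'(1)] in \<open>auto intro!: strip(1)\<close>)
        also have "\<dots> = e / 2" by (simp add: d_def mult_exp_exp)
        also have "\<dots> < e" using e by simp
        finally show ?case by (simp add: dist_real_def)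
      qed
    qed
    then show ?thesis using LIMSEQ_Suc[OF ptlim[OF s]] LIMSEQ_unique by blast
  qed
  have "frozen_solution S v v y'" for S
    unfolding frozen_solution_def
  proof (intro conjI allI impI)
    fix s assume s: "0 < s" "s < S"
    show "(v has_real_derivative y' s) (at s)"
      by (rule has_field_derivative_transform_within_open[OF frozen_solutionD(1)[OF v'(2) s], of "{0<..}"])
         (use eq s in auto)
    show "(y' has_real_derivative (A * v s - (c (v s) + b * s) * y' s) / s\<^sup>2) (at s)"
      by (rule frozen_solutionD(2)[OF v'(2) s])
  next
    have "(v' \<longlongrightarrow> v0) (at_right 0)" using v'(2) by (simp add: frozen_solution_def)
    then show "(v \<longlongrightarrow> v0) (at_right 0)"
      by (rule Lim_transform_eventually) (auto simp: eventually_at_right_field eq intro!: exI[of _ 1])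
  qed
  then show thesis using Xv by (intro that) (auto simp: X_def)
qed

text \<open>
By the mean value theorem on \<open>(t / 4, t / 2)\<close>: if \<open>v\<close> is within \<open>1\<close> of its limit there, some \<open>z\<close> in
this interval has \<open>\<bar>y z\<bar> < 2 / (t / 4)\<close>.
\<close>

lemma solution_frequently_bounded:
  assumes deriv: "\<And>s. 0 < s \<Longrightarrow> (v has_real_derivative y s) (at s)"
    and lim: "(v \<longlongrightarrow> l) (at_right 0)"
  shows "\<exists>\<^sub>F s in at_right 0. \<bar>s * y s\<bar> \<le> (4::real)"
  unfolding frequently_def
proof
  assume "\<forall>\<^sub>F s in at_right 0. \<not> \<bar>s * y s\<bar> \<le> 4"
  moreover have "\<forall>\<^sub>F s in at_right 0. \<bar>v s - l\<bar> < 1"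
    using tendstoD[OF lim, of 1] by (simp add: dist_real_def)
  ultimately have "\<forall>\<^sub>F s in at_right 0. \<not> \<bar>s * y s\<bar> \<le> 4 \<and> \<bar>v s - l\<bar> < 1" by (rule eventually_conj)
  then obtain t where t: "0 < t" "\<And>s. 0 < s \<Longrightarrow> s < t \<Longrightarrow> \<not> \<bar>s * y s\<bar> \<le> 4 \<and> \<bar>v s - l\<bar> < 1"
    by (auto simp: eventually_at_right_field)
  have "\<exists>z. t/4 < z \<and> z < t/2 \<and> v (t/2) - v (t/4) = (t/2 - t/4) * y z"
    by (rule MVT2) (use t(1) deriv in auto)
  then obtain z where z: "t/4 < z" "z < t/2" "v (t/2) - v (t/4) = (t/2 - t/4) * y z" by blast
  have "\<bar>t / 4 * y z\<bar> < 2" using z(3) t(2)[of "t/2"] t(2)[of "t/4"] t(1) by (simp add: abs_if split: if_splits)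
  moreover have "\<bar>z * y z\<bar> \<le> 2 * \<bar>t / 4 * y z\<bar>"
  proof -
    have "\<bar>z\<bar> * \<bar>y z\<bar> \<le> (t / 2) * \<bar>y z\<bar>" using z t(1) by (intro mult_right_mono) auto
    then show ?thesis using t(1) by (simp add: abs_mult)
  qed
  ultimately have "\<bar>z * y z\<bar> \<le> 4" by linarith
  then show False using t(2)[of z] z t(1) by auto
qed

text \<open>
The equation by itself would allow \<open>y\<close> to grow exponentially in \<open>1 / s\<close> at the origin; the existence of
the limit \<open>v0\<close> rules this out through \<open>solution_frequently_bounded\<close>. Comparison with \<open>0\<close> gives
\<open>0 \<le> y\<close>, hence \<open>v0 \<le> v\<close>, and comparison with a multiple of \<open>exp (L * s)\<close> then bounds \<open>y\<close>. The
conclusion covers all larger constants so that two solutions can be put into a common strip.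
\<close>

lemma solution_in_strip:
  assumes sol: "\<And>S. frozen_solution S v v y" and pos: "\<And>s. 0 < s \<Longrightarrow> 0 < v s" and S: "0 < S"
  obtains V M where "\<And>V' M'. V \<le> V' \<Longrightarrow> M \<le> M' \<Longrightarrow> in_strip S V' M' v y" "0 \<le> M"
proof -
  have dv: "(v has_real_derivative y s) (at s)"
    and dy: "(y has_real_derivative (A * v s - (c (v s) + b * s) * y s) / s\<^sup>2) (at s)" if "0 < s" for s
    using frozen_solutionD[OF sol, of s "s + 1"] that by auto
  have lim: "(v \<longlongrightarrow> v0) (at_right 0)" using sol by (auto simp: frozen_solution_def)
  have cont: "continuous_on {0<..} v"
    by (rule DERIV_continuous_on[where D = y], rule has_field_derivative_at_within) (use dv in auto)
  then have contS: "continuous_on {0<..<T} v" for T by (rule continuous_on_subset) auto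
  have ev: "\<forall>\<^sub>F s in at_right 0. v0 / 2 \<le> v s"
    using order_tendstoD(1)[OF lim, of "v0/2"] v0_pos by (auto elim: eventually_mono)
  have freq: "\<exists>\<^sub>F s in at_right 0. \<bar>s * y s\<bar> \<le> 4" by (rule solution_frequently_bounded[OF dv lim])
  have y0: "0 \<le> y s" if s: "0 < s" for s
  proof (rule frozen_comparison[where u = v and S = "s + 1", OF dy _ contS pos ev])
    show "0 \<le> t\<^sup>2 * ((A * v t - (c (v t) + b * t) * y t) / t\<^sup>2) + (c (v t) + b * t) * y t" if "0 < t" for t
      using that pos[OF that] A_nonneg by simp
    show "\<exists>\<^sub>F s in at_right 0. - 4 \<le> s * y s" by (rule frequently_elim1[OF freq]) auto
  qed (use s in auto)
  have mono: "v s \<le> v t" if "0 < s" "s \<le> t" for s t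
    by (rule deriv_nonneg_imp_mono[of s t v y]) (use that dv y0 in auto)
  have low: "v0 \<le> v s" if s: "0 < s" for s
    by (rule limit_at_0_le_of_deriv_nonneg[OF dv y0 lim s, of "s + 1"]) auto
  have c0: "0 < c v0" using c_pos v0_pos by simp
  define L where "L = b\<^sup>2 / (2 * c v0)"
  have L0: "0 \<le> L" using c0 by (simp add: L_def)
  define K where "K = 2 * A * v S / c v0"
  have K0: "0 \<le> K" using A_nonneg pos[OF S] c0 by (simp add: K_def)
  have yK: "y s \<le> K * exp (L * s)" if s: "0 < s" "s < S" for s
  proof -
    have "0 \<le> K * exp (L * s) - y s"
    proof (rule frozen_comparison[where u = v and S = S and D = "\<lambda>s. K * exp (L * s) - y s", OF _ _ contS pos ev])
      fix t assume t: "0 < t" "t < S"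
      let ?D' = "K * L * exp (L * t) - (A * v t - (c (v t) + b * t) * y t) / t\<^sup>2"
      show "((\<lambda>s. K * exp (L * s) - y s) has_real_derivative ?D') (at t)"
        by (auto intro!: derivative_eq_intros dy t)
      have "A * v t \<le> A * v S" using mono[of t S] t A_nonneg by (intro mult_left_mono) auto
      also have "\<dots> = K * 1 * (c v0 / 2)" using c0 by (simp add: K_def)
      also have "\<dots> \<le> K * exp (L * t) * (c v0 / 2)"
        using K0 L0 c0 t by (intro mult_right_mono mult_left_mono) auto
      also have "\<dots> \<le> K * exp (L * t) * (L * t\<^sup>2 + (c (v t) + b * t))"
        using coeff_lower_bound[OF _ low[OF t(1)], of L t] K0 by (intro mult_left_mono) (auto simp: L_def)
      finally have "0 \<le> K * exp (L * t) * (L * t\<^sup>2 + (c (v t) + b * t)) - A * v t" by simp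
      also have "\<dots> = t\<^sup>2 * ?D' + (c (v t) + b * t) * (K * exp (L * t) - y t)"
        using t(1) by (simp add: field_simps)
      finally show "0 \<le> t\<^sup>2 * ?D' + (c (v t) + b * t) * (K * exp (L * t) - y t)" .
    next
      have pos: "\<forall>\<^sub>F s in at_right (0::real). 0 < s" by (auto simp: eventually_at_right_field intro!: exI[of _ 1])
      show "\<exists>\<^sub>F s in at_right 0. - 4 \<le> s * (K * exp (L * s) - y s)"
      proof (rule frequently_rev_mp[OF freq], rule eventually_mono[OF pos], rule impI)
        fix s :: real assume s: "0 < s" "\<bar>s * y s\<bar> \<le> 4"
        have "0 \<le> s * (K * exp (L * s))" using s K0 by simp
        with s show "- 4 \<le> s * (K * exp (L * s) - y s)" by (simp add: right_diff_distrib)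
      qed
    qed (use s in auto)
    then show ?thesis by simp
  qed
  have "K * exp (L * s) \<le> K * exp (L * S)" if "s < S" for s
    using that K0 L0 by (auto intro!: mult_left_mono)
  then have "in_strip S V' M' v y" if "v S \<le> V'" "K * exp (L * S) \<le> M'" for V' M'
    unfolding in_strip_def
  proof (intro conjI allI impI)
    fix s assume s: "0 < s" "s < S"
    show "v s \<le> V'" using mono[of s S] that(1) s by linarith
    show "y s \<le> M'" using yK[OF s] \<open>\<And>s. s < S \<Longrightarrow> K * exp (L * s) \<le> K * exp (L * S)\<close>[OF s(2)] that(2) by linarith
  qed (use contS low y0 in auto)
  then show thesis by (rule that[where M = "K * exp (L * S)"]) (use K0 in auto)
qed

text \<open>
Both solutions are fixed points in a common strip, so their weighted distance is at most half of itself.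
\<close>

lemma solution_unique:
  assumes 1: "\<And>S. frozen_solution S v1 v1 y1" "\<And>s. 0 < s \<Longrightarrow> 0 < v1 s"
    and 2: "\<And>S. frozen_solution S v2 v2 y2" "\<And>s. 0 < s \<Longrightarrow> 0 < v2 s"
    and s: "0 < s"
  shows "v1 s = v2 s"
proof -
  define S where "S = s + 1"
  have S: "0 < S" "s < S" using s by (auto simp: S_def)
  obtain V1 M1 where V1: "\<And>V' M'. V1 \<le> V' \<Longrightarrow> M1 \<le> M' \<Longrightarrow> in_strip S V' M' v1 y1" "0 \<le> M1"
    using solution_in_strip[OF 1 S(1)] by blast
  obtain V2 M2 where V2: "\<And>V' M'. V2 \<le> V' \<Longrightarrow> M2 \<le> M' \<Longrightarrow> in_strip S V' M' v2 y2" "0 \<le> M2"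
    using solution_in_strip[OF 2 S(1)] by blast
  define V M where "V = max V1 V2" and "M = max M1 M2"
  have strip: "in_strip S V M v1 y1" "in_strip S V M v2 y2" and M: "0 \<le> M"
    using V1 V2 by (auto simp: V_def M_def)
  obtain L where L: "contraction_weight S V M L" and L0: "0 \<le> L"
    using contraction_weight_exists[OF M, of S V] by (auto simp: contraction_weight_def)
  have bound: "\<bar>v1 t - v2 t\<bar> \<le> V * (1/2)^n * exp (L * t)" if "0 < t" "t < S" for n t
    using that
  proof (induction n arbitrary: t)
    case 0
    have "v0 \<le> v1 t" "v1 t \<le> V" "v0 \<le> v2 t" "v2 t \<le> V" using strip 0 by (auto simp: in_strip_def)
    then have V: "\<bar>v1 t - v2 t\<bar> \<le> V * 1" "0 \<le> V" using v0_pos by linarith+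
    note V(1)
    also have "V * 1 \<le> V * exp (L * t)" using 0 V L0 by (intro mult_left_mono) auto
    finally show ?case by simp
  next
    case (Suc n)
    have "\<bar>v1 t - v2 t\<bar> \<le> (V * (1/2)^n) / 2 * exp (L * t)"
      by (rule contraction_weightD[OF L 1(1) 2(1) strip]) (use Suc in auto)
    then show ?case by simp
  qed
  have "(\<lambda>n. V * (1/2)^n * exp (L * s)) \<longlonglongrightarrow> V * 0 * exp (L * s)"
    by (intro tendsto_intros LIMSEQ_power_zero) simp
  then have "\<bar>v1 s - v2 s\<bar> \<le> V * 0 * exp (L * s)"
    by (rule LIMSEQ_le_const) (use bound s S in auto)
  then show ?thesis by simp
qed

end

section \<open>Transformation of the radial equation\<close>

lemma has_real_derivative_powr_const:
  fixes r a :: real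
  assumes "0 < r"
  shows "((\<lambda>r. r powr a) has_real_derivative a * r powr a / r) (at r)"
  using has_real_derivative_powr[OF assms, of a] assms by (simp add: powr_diff)

lemma has_real_derivative_powr_compose:
  fixes F :: "real \<Rightarrow> real"
  assumes "(F has_real_derivative F') (at s)" "0 < F s"
  shows "((\<lambda>s. F s powr p) has_real_derivative p * F s powr (p - 1) * F') (at s)"
  using DERIV_chain2[OF has_real_derivative_powr[OF assms(2), of p] assms(1)] by simp

lemma powr_lipschitz_on_interval:
  fixes a V p :: real
  assumes a: "0 < a" and p: "0 \<le> p"
  shows "\<exists>K\<ge>0. \<forall>x\<in>{a..V}. \<forall>y\<in>{a..V}. \<bar>x powr p - y powr p\<bar> \<le> K * \<bar>x - y\<bar>"
proof -
  define K where "K = p * (a powr (p - 1) + V powr (p - 1))"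
  have bound: "norm (p * x powr (p - 1)) \<le> K" if "x \<in> {a..V}" for x
  proof -
    have "x powr (p - 1) \<le> a powr (p - 1) + V powr (p - 1)"
    proof (cases "1 \<le> p")
      case True
      then have "x powr (p - 1) \<le> V powr (p - 1)" using that a by (intro powr_mono2) auto
      then show ?thesis by (simp add: add_increasing)
    next
      case False
      then have "x powr (p - 1) \<le> a powr (p - 1)" using that a by (intro powr_mono2') auto
      then show ?thesis by (simp add: add_increasing2)
    qed
    then show ?thesis using p by (auto simp: K_def abs_mult intro: mult_left_mono)
  qed
  have "norm (x powr p - y powr p) \<le> K * norm (x - y)" if "x \<in> {a..V}" "y \<in> {a..V}" for x y
    by (rule field_differentiable_bound[OF convex_real_interval(5) _ bound that])
       (use a in \<open>auto intro!: has_field_derivative_at_within has_real_derivative_powr\<close>)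
  moreover have "0 \<le> K" using p by (simp add: K_def)
  ultimately show ?thesis by (intro exI[of _ K]) (auto simp: real_norm_def)
qed

lemma filterlim_powr_at_right_0:
  assumes "0 < (a::real)"
  shows "filterlim (\<lambda>r. r powr a) (at_right 0) (at_right 0)"
  unfolding filterlim_at
proof
  have "((\<lambda>r. r powr a) \<longlongrightarrow> 0 powr a) (at_right 0)"
    by (rule tendsto_powr') (use assms in \<open>auto intro!: tendsto_intros simp: eventually_at_right_field intro: exI[of _ 1]\<close>)
  then show "((\<lambda>r. r powr a) \<longlongrightarrow> 0) (at_right 0)" by simp
  show "\<forall>\<^sub>F r in at_right 0. r powr a \<in> {0<..} \<and> r powr a \<noteq> 0"
    by (auto simp: eventually_at_right_field intro!: exI[of _ 1])
qed

text \<open>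
The exponent \<open>k\<close> is the one for which \<open>r powr (- k)\<close> is annihilated by \<open>\<alpha> f + \<beta> r f'\<close>. The exponent
\<open>\<delta>\<close> is the gain in powers of \<open>r\<close> of the diffusion over the drift on this function, and so \<open>r powr \<delta>\<close>
is the natural variable for the correction to it.
\<close>

locale self_similar =
  fixes n :: nat and m k \<delta> \<alpha> \<beta> :: real
  assumes m_pos: "0 < m" and \<delta>_pos: "0 < \<delta>" and \<delta>_eq: "\<delta> = k - k * m - 2" and \<alpha>_eq: "\<alpha> = k * \<beta>"
begin

definition drift :: real where "drift = 1 + (real n - 2 - 2 * m * k) / \<delta>"
definition source :: real where "source = m * k * (real n - 2 - m * k) / \<delta>\<^sup>2"
definition diffusivity :: "real \<Rightarrow> real" where "diffusivity x = \<beta> / \<delta> * x powr (1 / m - 1)"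

text \<open>
The identity behind the change of variables: the left-hand side of the radial equation equals
\<open>r powr (- k * m) / (m * r^2)\<close> times \<open>\<delta>^2\<close> times the defect of the equation for \<open>V\<close>. The drift term
carries the factor \<open>r powr (- k) * s\<close>, and the relation between \<open>\<delta>\<close> and \<open>k\<close> makes this the same
power of \<open>r\<close> as in the diffusion term.
\<close>

lemma radial_eq_iff:
  assumes V: "\<And>s. 0 < s \<Longrightarrow> (V has_real_derivative y s) (at s)"
    and y: "\<And>s. 0 < s \<Longrightarrow> (y has_real_derivative z s) (at s)"
    and pos: "\<And>s. 0 < s \<Longrightarrow> 0 < V s"
    and f: "\<And>r. 0 < r \<Longrightarrow> f r = r powr (- k) * V (r powr \<delta>) powr (1 / m)"
    and r: "0 < r"
  defines "s \<equiv> r powr \<delta>"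
  shows "radial_eq n m \<alpha> \<beta> f r \<longleftrightarrow> s\<^sup>2 * z s + (diffusivity (V s) + drift * s) * y s = source * V s"
proof -
  have s: "0 < s" using r by (simp add: s_def)
  \<comment> \<open>named factors, so that differentiation does not unfold the powers\<close>
  define P Q R where "P = (\<lambda>r::real. r powr (- k * m))" and "Q = (\<lambda>r::real. r powr (- k))"
    and "R = (\<lambda>r::real. r powr \<delta>)"
  define v w x where "v = (\<lambda>r. V (R r))" and "w = (\<lambda>r. y (R r))" and "x = (\<lambda>r. z (R r))"
  define B where "B = (\<lambda>r. v r powr (1 / m))"
  have dP: "(P has_real_derivative - k * m * P r / r) (at r)"
    and dQ: "(Q has_real_derivative - k * Q r / r) (at r)"
    and dR: "(R has_real_derivative \<delta> * R r / r) (at r)" and R: "0 < R r" if "0 < r" for r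
    using that has_real_derivative_powr_const[OF that, of "- k * m"]
      has_real_derivative_powr_const[OF that, of "- k"] has_real_derivative_powr_const[OF that, of \<delta>]
    by (auto simp: P_def Q_def R_def)
  have dv: "(v has_real_derivative w r * (\<delta> * R r / r)) (at r)"
    and dw: "(w has_real_derivative x r * (\<delta> * R r / r)) (at r)" and v: "0 < v r" if "0 < r" for r
    using DERIV_chain2[OF V[OF R[OF that]] dR[OF that]] DERIV_chain2[OF y[OF R[OF that]] dR[OF that]]
      pos[OF R[OF that]] by (auto simp: v_def w_def x_def)
  have dB: "(B has_real_derivative 1 / m * v r powr (1 / m - 1) * (w r * (\<delta> * R r / r))) (at r)" if "0 < r" for r
    unfolding B_def by (rule has_real_derivative_powr_compose[OF dv v]) (use that in auto)
  have at_r: "R r = s" "v r = V s" "w r = y s" "x r = z s" "B r = V s powr (1 / m)"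
    by (auto simp: R_def s_def v_def w_def x_def B_def)
  define X where "X = P r"
  have fm: "f r powr m / m = P r * v r / m" if "0 < r" for r
    using that v[OF that] m_pos by (simp add: f powr_mult powr_powr P_def v_def R_def)
  define u1 where "u1 = (\<lambda>r. P r * (\<delta> * R r * w r - k * m * v r) / (m * r))"
  have d1: "((\<lambda>s. f s powr m / m) has_real_derivative u1 r) (at r)" if r: "0 < r" for r
  proof (rule has_field_derivative_transform_within_open[where S = "{0<..}"])
    show "((\<lambda>r. P r * v r / m) has_real_derivative u1 r) (at r)"
      using r m_pos unfolding u1_def
      by (auto intro!: derivative_eq_intros dP dv simp: field_simps)
  qed (use r fm m_pos in auto)
  have deriv1: "deriv (\<lambda>s. f s powr m / m) r = u1 r" if "0 < r" for r
    by (rule DERIV_imp_deriv[OF d1[OF that]])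
  define u2 where "u2 = X / (m * r\<^sup>2) * (\<delta>\<^sup>2 * s\<^sup>2 * z s + \<delta> * s * (\<delta> - 2 * k * m - 1) * y s + k * m * (k * m + 1) * V s)"
  have d2: "((\<lambda>r. deriv (\<lambda>s. f s powr m / m) r) has_real_derivative u2) (at r)"
  proof (rule has_field_derivative_transform_within_open[where S = "{0<..}"])
    show "(u1 has_real_derivative u2) (at r)"
      using r m_pos unfolding u1_def u2_def X_def unfolding at_r(2-5)[symmetric] unfolding at_r(1)[symmetric]
      by (auto intro!: derivative_eq_intros dP dR dv dw) (auto simp: field_simps power2_eq_square)
  qed (use r deriv1 in auto)
  define f1 where "f1 = Q r / r * (\<delta> / m * s * V s powr (1 / m - 1) * y s - k * V s powr (1 / m))"
  have df: "(f has_real_derivative f1) (at r)"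
  proof (rule has_field_derivative_transform_within_open[where S = "{0<..}"])
    show "((\<lambda>r. Q r * B r) has_real_derivative f1) (at r)"
      using r m_pos unfolding f1_def unfolding at_r(2-5)[symmetric] unfolding at_r(1)[symmetric]
      by (auto intro!: derivative_eq_intros dQ dB) (auto simp: field_simps B_def)
  qed (use r f in \<open>auto simp: Q_def B_def v_def R_def\<close>)
  have "- k + \<delta> = - k * m - 2" using \<delta>_eq by simp
  then have "r powr (- k) * s = r powr (- k * m - 2)"
    unfolding s_def by (simp only: powr_add[symmetric])
  also have "\<dots> = X / r\<^sup>2" using r by (simp add: X_def P_def powr_diff)
  finally have Xs: "r powr (- k) * s = X / r\<^sup>2" .
  have "\<alpha> * f r + \<beta> * r * f1 = \<beta> * (r powr (- k) * s) * (\<delta> / m) * V s powr (1 / m - 1) * y s"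
    using r by (simp add: f f1_def Q_def s_def[symmetric] \<alpha>_eq field_simps)
  also have "\<dots> = X / (m * r\<^sup>2) * (\<delta>\<^sup>2 * diffusivity (V s) * y s)"
    unfolding Xs using \<delta>_pos by (simp add: diffusivity_def power2_eq_square ac_simps)
  finally have low: "\<alpha> * f r + \<beta> * r * f1 = X / (m * r\<^sup>2) * (\<delta>\<^sup>2 * diffusivity (V s) * y s)" .
  have u1r: "(real n - 1) / r * u1 r = X / (m * r\<^sup>2) * ((real n - 1) * (\<delta> * s * y s - k * m * V s))"
    using r by (simp add: u1_def X_def at_r power2_eq_square ac_simps)
  have "u2 + (real n - 1) / r * u1 r + (\<alpha> * f r + \<beta> * r * f1)
      = X / (m * r\<^sup>2) * (\<delta>\<^sup>2 * s\<^sup>2 * z s + \<delta> * s * (\<delta> - 2 * k * m - 1) * y s + k * m * (k * m + 1) * V s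
          + (real n - 1) * (\<delta> * s * y s - k * m * V s) + \<delta>\<^sup>2 * diffusivity (V s) * y s)"
    unfolding low u1r by (simp add: u2_def distrib_left)
  also have "\<delta>\<^sup>2 * s\<^sup>2 * z s + \<delta> * s * (\<delta> - 2 * k * m - 1) * y s + k * m * (k * m + 1) * V s
          + (real n - 1) * (\<delta> * s * y s - k * m * V s) + \<delta>\<^sup>2 * diffusivity (V s) * y s
      = \<delta>\<^sup>2 * (s\<^sup>2 * z s + (diffusivity (V s) + drift * s) * y s - source * V s)"
    using \<delta>_pos by (simp add: drift_def source_def field_simps power2_eq_square)
  finally have key: "u2 + (real n - 1) / r * u1 r + (\<alpha> * f r + \<beta> * r * f1)
      = X / (m * r\<^sup>2) * (\<delta>\<^sup>2 * (s\<^sup>2 * z s + (diffusivity (V s) + drift * s) * y s - source * V s))" .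
  have "radial_eq n m \<alpha> \<beta> f r \<longleftrightarrow> u2 + (real n - 1) / r * u1 r + (\<alpha> * f r + \<beta> * r * f1) = 0"
    unfolding radial_eq_def using DERIV_imp_deriv[OF d2] deriv1[OF r] DERIV_imp_deriv[OF df] by (simp add: add.assoc)
  moreover have "0 < X / (m * r\<^sup>2)" using r m_pos by (simp add: X_def P_def)
  ultimately show ?thesis unfolding key using \<delta>_pos by auto
qed

lemma C2_on_profile:
  assumes V: "\<And>s. 0 < s \<Longrightarrow> (V has_real_derivative y s) (at s)"
    and y: "\<And>s. 0 < s \<Longrightarrow> (y has_real_derivative z s) (at s)"
    and z: "continuous_on {0<..} z"
    and pos: "\<And>s. 0 < s \<Longrightarrow> 0 < V s"
    and f: "\<And>r. 0 < r \<Longrightarrow> f r = r powr (- k) * V (r powr \<delta>) powr (1 / m)"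
  shows "C2_on {0<..} f"
proof -
  define p where "p = 1 / m"
  define Q R where "Q = (\<lambda>r::real. r powr (- k))" and "R = (\<lambda>r::real. r powr \<delta>)"
  define v w x where "v = (\<lambda>r. V (R r))" and "w = (\<lambda>r. y (R r))" and "x = (\<lambda>r. z (R r))"
  define B where "B = (\<lambda>q r. v r powr q)"
  have dQ: "(Q has_real_derivative - k * Q r / r) (at r)"
    and dR: "(R has_real_derivative \<delta> * R r / r) (at r)" and R: "0 < R r" if "0 < r" for r
    using that has_real_derivative_powr_const[OF that, of "- k"] has_real_derivative_powr_const[OF that, of \<delta>]
    by (auto simp: Q_def R_def)
  have dv: "(v has_real_derivative w r * (\<delta> * R r / r)) (at r)"
    and dw: "(w has_real_derivative x r * (\<delta> * R r / r)) (at r)" and vpos: "0 < v r" if "0 < r" for r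
    using DERIV_chain2[OF V[OF R[OF that]] dR[OF that]] DERIV_chain2[OF y[OF R[OF that]] dR[OF that]]
      pos[OF R[OF that]] by (auto simp: v_def w_def x_def)
  have dB: "(B q has_real_derivative q * B (q - 1) r * (w r * (\<delta> * R r / r))) (at r)" if "0 < r" for q r
    unfolding B_def by (rule has_real_derivative_powr_compose[OF dv vpos]) (use that in auto)
  define f1 where "f1 = (\<lambda>r. Q r / r * (\<delta> * p * (R r * B (p - 1) r * w r) - k * B p r))"
  define f2 where "f2 = (\<lambda>r. - (k + 1) * Q r / r\<^sup>2 * (\<delta> * p * (R r * B (p - 1) r * w r) - k * B p r)
    + Q r / r * (\<delta> * p * (\<delta> * R r / r * (B (p - 1) r * w r + (p - 1) * R r * B (p - 1 - 1) r * (w r)\<^sup>2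
        + R r * B (p - 1) r * x r)) - k * p * B (p - 1) r * w r * \<delta> * R r / r))"
  have df: "(f has_real_derivative f1 r) (at r)" if r: "0 < r" for r
  proof (rule has_field_derivative_transform_within_open[where S = "{0<..}"])
    show "((\<lambda>r. Q r * B p r) has_real_derivative f1 r) (at r)"
      using r unfolding f1_def
      by (auto intro!: derivative_eq_intros dQ dB) (auto simp: field_simps)
  qed (use r f in \<open>auto simp: p_def Q_def B_def v_def R_def\<close>)
  have df1: "(f1 has_real_derivative f2 r) (at r)" if r: "0 < r" for r
    using r unfolding f1_def f2_def
    by (auto intro!: derivative_eq_intros dQ dR dw dB) (auto simp: field_simps power2_eq_square)
  have cont: "continuous_on {0<..} Q" "continuous_on {0<..} R" "continuous_on {0<..} v"
    "continuous_on {0<..} w" "continuous_on {0<..} (B q)" for q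
    by (rule DERIV_continuous_on, rule has_field_derivative_at_within, rule dQ dR dv dw dB, simp)+
  have contx: "continuous_on {0<..} x" unfolding x_def
    by (rule continuous_on_compose2[OF z cont(2)]) (use R in auto)
  have contf2: "continuous_on {0<..} f2" unfolding f2_def
    by (intro continuous_intros cont contx) auto
  have "(deriv f has_vector_derivative f2 r) (at r)" if "0 < r" for r
    unfolding has_real_derivative_iff_has_vector_derivative[symmetric]
    by (rule has_field_derivative_transform_within_open[OF df1[OF that], of "{0<..}"])
       (use that DERIV_imp_deriv[OF df] in auto)
  moreover have "f differentiable_on {0<..}"
    using df by (intro differentiable_at_imp_differentiable_on) (auto simp: real_differentiable_def)
  ultimately show ?thesis
    unfolding C2_on_def C1_differentiable_on_def using contf2 by auto
qed

lemma profile_of_C2: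
  assumes f: "C2_on {0<..} f" and fpos: "\<And>r. 0 < r \<Longrightarrow> 0 < f r"
  defines "V \<equiv> (\<lambda>s. (s powr (k / \<delta>) * f (s powr (1 / \<delta>))) powr m)"
  obtains y z where "\<And>s. 0 < s \<Longrightarrow> (V has_real_derivative y s) (at s)"
    "\<And>s. 0 < s \<Longrightarrow> (y has_real_derivative z s) (at s)"
    "\<And>s. 0 < s \<Longrightarrow> 0 < V s"
    "\<And>r. 0 < r \<Longrightarrow> f r = r powr (- k) * V (r powr \<delta>) powr (1 / m)"
proof -
  note dp = has_real_derivative_powr_const
  obtain g' where df: "\<And>r. 0 < r \<Longrightarrow> (f has_real_derivative deriv f r) (at r)"
    and dg: "\<And>r. 0 < r \<Longrightarrow> (deriv f has_real_derivative g' r) (at r)"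
  proof -
    have "f differentiable (at r)" if "0 < r" for r
      using f that by (simp add: C2_on_def differentiable_on_eq_differentiable_at)
    then have "(f has_real_derivative deriv f r) (at r)" if "0 < r" for r
      using that by (metis DERIV_imp_deriv real_differentiable_def)
    then show thesis using that f
      by (auto simp: C2_on_def C1_differentiable_on_def has_real_derivative_iff_has_vector_derivative)
  qed
  define F where "F = (\<lambda>s. s powr (k / \<delta>) * f (s powr (1 / \<delta>)))"
  define G where "G = (\<lambda>s. s powr (k / \<delta>) * (deriv f (s powr (1 / \<delta>)) * s powr (1 / \<delta>)))"
  define F1 where "F1 = (\<lambda>s. (k * F s + G s) / (\<delta> * s))"
  have Fpos: "0 < F s" if "0 < s" for s using that fpos by (simp add: F_def)
  have dF: "(F has_real_derivative F1 s) (at s)" if s: "0 < s" for s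
    unfolding F_def
    by (rule DERIV_cong[OF DERIV_mult[OF dp[OF s] DERIV_chain2[OF df dp[OF s]]]])
       (use s \<delta>_pos in \<open>auto simp: F1_def F_def G_def field_simps\<close>)
  have dG: "\<exists>D. (G has_real_derivative D) (at s)" if s: "0 < s" for s
    unfolding G_def
    by (rule exI, rule DERIV_mult[OF dp[OF s] DERIV_mult[OF DERIV_chain2[OF dg dp[OF s]] dp[OF s]]]) (use s in simp)
  have dF1: "\<exists>D. (F1 has_real_derivative D) (at s)" if s: "0 < s" for s
  proof -
    obtain G' where G': "(G has_real_derivative G') (at s)" using dG[OF s] by blast
    show ?thesis unfolding F1_def
      by (rule exI, rule DERIV_divide[OF DERIV_add[OF DERIV_cmult[OF dF[OF s]] G'] DERIV_cmult[OF DERIV_ident]])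
         (use s \<delta>_pos in simp)
  qed
  define y where "y = (\<lambda>s. m * F s powr (m - 1) * F1 s)"
  have dV: "(V has_real_derivative y s) (at s)" if s: "0 < s" for s
    using has_real_derivative_powr_compose[OF dF[OF s] Fpos[OF s], of m] unfolding V_def F_def y_def by simp
  have dy: "\<exists>D. (y has_real_derivative D) (at s)" if s: "0 < s" for s
  proof -
    obtain D where D: "(F1 has_real_derivative D) (at s)" using dF1[OF s] by blast
    show ?thesis unfolding y_def
      by (rule exI, rule DERIV_mult[OF DERIV_cmult[OF has_real_derivative_powr_compose[OF dF[OF s] Fpos[OF s]]] D])
  qed
  then obtain z where dz: "\<And>s. 0 < s \<Longrightarrow> (y has_real_derivative z s) (at s)" by metis
  show thesis
  proof (rule that[OF dV dz])
    show "0 < V s" if "0 < s" for s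
      unfolding V_def using Fpos[OF that] unfolding F_def by auto
    show "f r = r powr (- k) * V (r powr \<delta>) powr (1 / m)" if "0 < r" for r
      using that fpos[OF that] m_pos \<delta>_pos
      by (simp add: V_def powr_powr powr_mult powr_add[symmetric] mult.assoc[symmetric])
  qed
qed

text \<open>
The sign of the source term is where \<open>k \<le> (n - 2) / m\<close> enters.
\<close>

lemma singular_ode_profile:
  assumes "m < 1" "0 < \<beta>" "0 \<le> k" "m * k \<le> real n - 2" "0 < v0"
  shows "singular_ode diffusivity source v0"
proof
  have p: "0 \<le> 1 / m - 1" using assms m_pos by (simp add: field_simps)
  have q: "0 < \<beta> / \<delta>" using assms \<delta>_pos by simp
  show "0 \<le> source" using assms m_pos by (simp add: source_def)
  show "continuous_on {0<..} diffusivity"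
    unfolding diffusivity_def by (intro continuous_intros) auto
  show "0 < diffusivity x" if "0 < x" for x 
      unfolding diffusivity_def using that q by (intro mult_pos_pos) auto
  show "diffusivity x \<le> diffusivity y" if "0 < x" "x \<le> y" for x y
    unfolding diffusivity_def using that p q by (intro mult_left_mono powr_mono2) auto
  show "\<exists>K\<ge>0. \<forall>x\<in>{v0..V}. \<forall>y\<in>{v0..V}. \<bar>diffusivity x - diffusivity y\<bar> \<le> K * \<bar>x - y\<bar>" for V
  proof -
    obtain K where K: "0 \<le> K"
      "\<forall>x\<in>{v0..V}. \<forall>y\<in>{v0..V}. \<bar>x powr (1/m - 1) - y powr (1/m - 1)\<bar> \<le> K * \<bar>x - y\<bar>"
      using powr_lipschitz_on_interval[OF \<open>0 < v0\<close> p] by blast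
    show ?thesis
    proof (intro exI[of _ "\<beta> / \<delta> * K"] conjI ballI)
      fix x y assume "x \<in> {v0..V}" "y \<in> {v0..V}"
      then have "\<beta> / \<delta> * \<bar>x powr (1/m - 1) - y powr (1/m - 1)\<bar> \<le> \<beta> / \<delta> * (K * \<bar>x - y\<bar>)"
        using K(2) q by (intro mult_left_mono) auto
      moreover have "\<bar>diffusivity x - diffusivity y\<bar> = \<beta> / \<delta> * \<bar>x powr (1/m - 1) - y powr (1/m - 1)\<bar>"
        using q unfolding diffusivity_def by (simp only: right_diff_distrib[symmetric] abs_mult abs_of_pos)
      ultimately show "\<bar>diffusivity x - diffusivity y\<bar> \<le> \<beta> / \<delta> * K * \<bar>x - y\<bar>" by (simp add: mult.assoc)
    qed (rule mult_nonneg_nonneg[OF less_imp_le[OF q] K(1)])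
  qed
qed (use assms in auto)

definition is_profile :: "real \<Rightarrow> (real \<Rightarrow> real) \<Rightarrow> bool" where
  "is_profile \<eta> f \<longleftrightarrow> C2_on {0<..} f \<and> (\<forall>r>0. radial_eq n m \<alpha> \<beta> f r \<and> f r > 0)
     \<and> ((\<lambda>r. r powr k * f r) \<longlongrightarrow> \<eta>) (at_right 0)"

lemma is_profile_of_solution:
  assumes ode: "singular_ode diffusivity source v0"
    and sol: "\<And>S. singular_ode.frozen_solution diffusivity source drift v0 S v v y"
    and pos: "\<And>s. 0 < s \<Longrightarrow> 0 < v s" and v0: "v0 = \<eta> powr m" "0 < \<eta>"
    and f: "\<And>r. 0 < r \<Longrightarrow> f r = r powr (- k) * v (r powr \<delta>) powr (1 / m)"
  shows "is_profile \<eta> f"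
proof -
  interpret singular_ode diffusivity source drift v0 by fact
  define z where "z = (\<lambda>s. (source * v s - (diffusivity (v s) + drift * s) * y s) / s\<^sup>2)"
  have dv: "(v has_real_derivative y s) (at s)" and dy: "(y has_real_derivative z s) (at s)" if "0 < s" for s
    using frozen_solutionD[OF sol, of s "s + 1"] that by (auto simp: z_def)
  have lim: "(v \<longlongrightarrow> v0) (at_right 0)" using sol by (simp add: frozen_solution_def)
  have cont: "continuous_on {0<..} v" "continuous_on {0<..} y"
    by (rule DERIV_continuous_on, rule has_field_derivative_at_within, rule dv dy, simp)+
  have "continuous_on {0<..} (\<lambda>s. diffusivity (v s))"
    by (rule continuous_on_compose2[OF c_cont cont(1)]) (use pos in auto)
  then have contz: "continuous_on {0<..} z"
    unfolding z_def by (intro continuous_intros cont) auto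
  have fpos: "0 < f r" if "0 < r" for r using f[OF that] pos[of "r powr \<delta>"] that by simp
  have eq: "radial_eq n m \<alpha> \<beta> f r" if "0 < r" for r
    by (rule radial_eq_iff[OF dv dy pos f that, THEN iffD2]) (use that in \<open>auto simp: z_def\<close>)
  have "((\<lambda>r. v (r powr \<delta>) powr (1 / m)) \<longlongrightarrow> v0 powr (1 / m)) (at_right 0)"
    using v0_pos by (intro tendsto_powr filterlim_compose[OF lim filterlim_powr_at_right_0[OF \<delta>_pos]]) auto
  then have "((\<lambda>r. r powr k * f r) \<longlongrightarrow> v0 powr (1 / m)) (at_right 0)"
    by (rule Lim_transform_eventually)
       (auto simp: eventually_at_right_field f powr_add[symmetric] mult.assoc[symmetric] intro!: exI[of _ 1])
  moreover have "v0 powr (1 / m) = \<eta>" using v0 m_pos by (simp add: powr_powr)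
  ultimately show ?thesis
    unfolding is_profile_def using C2_on_profile[OF dv dy contz pos f] eq fpos by simp
qed

lemma solution_of_is_profile:
  assumes ode: "singular_ode diffusivity source v0"
    and f: "is_profile \<eta> f" and v0: "v0 = \<eta> powr m" "0 < \<eta>"
  obtains v y where "\<And>S. singular_ode.frozen_solution diffusivity source drift v0 S v v y"
    "\<And>s. 0 < s \<Longrightarrow> 0 < v s" "\<And>r. 0 < r \<Longrightarrow> f r = r powr (- k) * v (r powr \<delta>) powr (1 / m)"
proof -
  interpret singular_ode diffusivity source drift v0 by fact
  have C2: "C2_on {0<..} f" and fpos: "\<And>r. 0 < r \<Longrightarrow> 0 < f r"
    and eq: "\<And>r. 0 < r \<Longrightarrow> radial_eq n m \<alpha> \<beta> f r"
    and lim: "((\<lambda>r. r powr k * f r) \<longlongrightarrow> \<eta>) (at_right 0)"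
    using f by (auto simp: is_profile_def)
  define v where "v = (\<lambda>s. (s powr (k / \<delta>) * f (s powr (1 / \<delta>))) powr m)"
  obtain y z where dv: "\<And>s. 0 < s \<Longrightarrow> (v has_real_derivative y s) (at s)"
    and dy: "\<And>s. 0 < s \<Longrightarrow> (y has_real_derivative z s) (at s)"
    and pos: "\<And>s. 0 < s \<Longrightarrow> 0 < v s"
    and fv: "\<And>r. 0 < r \<Longrightarrow> f r = r powr (- k) * v (r powr \<delta>) powr (1 / m)"
    using profile_of_C2[OF C2 fpos] unfolding v_def by blast
  have z: "z s = (source * v s - (diffusivity (v s) + drift * s) * y s) / s\<^sup>2" if s: "0 < s" for s
  proof -
    define r where "r = s powr (1 / \<delta>)"
    have r: "0 < r" "r powr \<delta> = s" using s \<delta>_pos by (auto simp: r_def powr_powr)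
    have "s\<^sup>2 * z s + (diffusivity (v s) + drift * s) * y s = source * v s"
      using radial_eq_iff[OF dv dy pos fv r(1)] eq[OF r(1)] r(2) by simp
    then show ?thesis using s by (simp add: field_simps)
  qed
  have "0 < 1 / \<delta>" using \<delta>_pos by simp
  have "((\<lambda>s. ((s powr (1 / \<delta>)) powr k * f (s powr (1 / \<delta>))) powr m) \<longlongrightarrow> \<eta> powr m) (at_right 0)"
    using v0 by (intro tendsto_powr tendsto_const
      filterlim_compose[OF lim filterlim_powr_at_right_0[OF \<open>0 < 1 / \<delta>\<close>]]) auto
  then have "(v \<longlongrightarrow> v0) (at_right 0)" by (simp add: v_def v0 powr_powr)
  then have "frozen_solution S v v y" for S
    unfolding frozen_solution_def using dv dy z by auto
  then show thesis using pos fv by (rule that)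
qed

lemma profile_exists:
  assumes "m < 1" "0 < \<beta>" "0 \<le> k" "m * k \<le> real n - 2" "0 < \<eta>"
  shows "\<exists>f. f \<in> extensional {0<..} \<and> is_profile \<eta> f"
proof -
  have ode: "singular_ode diffusivity source (\<eta> powr m)"
    by (rule singular_ode_profile) (use assms in auto)
  obtain v y where sol: "\<And>S. singular_ode.frozen_solution diffusivity source drift (\<eta> powr m) S v v y"
    and low: "\<And>s. 0 < s \<Longrightarrow> \<eta> powr m \<le> v s"
    using singular_ode.solution_exists[OF ode] by blast
  have pos: "0 < v s" if "0 < s" for s using low[OF that] assms by (smt (verit) powr_gt_zero)
  define f where "f = restrict (\<lambda>r. r powr (- k) * v (r powr \<delta>) powr (1 / m)) {0<..}"
  have "is_profile \<eta> f"
    by (rule is_profile_of_solution[OF ode sol pos]) (use assms in \<open>auto simp: f_def\<close>)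
  then show ?thesis by (intro exI[of _ f]) (auto simp: f_def)
qed

lemma profile_unique:
  assumes "m < 1" "0 < \<beta>" "0 \<le> k" "m * k \<le> real n - 2" "0 < \<eta>"
    and f: "is_profile \<eta> f" and g: "is_profile \<eta> g" and r: "0 < r"
  shows "f r = g r"
proof -
  have ode: "singular_ode diffusivity source (\<eta> powr m)"
    by (rule singular_ode_profile) (use assms in auto)
  obtain v y where v: "\<And>S. singular_ode.frozen_solution diffusivity source drift (\<eta> powr m) S v v y"
    "\<And>s. 0 < s \<Longrightarrow> 0 < v s" "\<And>r. 0 < r \<Longrightarrow> f r = r powr (- k) * v (r powr \<delta>) powr (1 / m)"
    using solution_of_is_profile[OF ode f refl \<open>0 < \<eta>\<close>] by blast
  obtain w x where w: "\<And>S. singular_ode.frozen_solution diffusivity source drift (\<eta> powr m) S w w x"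
    "\<And>s. 0 < s \<Longrightarrow> 0 < w s" "\<And>r. 0 < r \<Longrightarrow> g r = r powr (- k) * w (r powr \<delta>) powr (1 / m)"
    using solution_of_is_profile[OF ode g refl \<open>0 < \<eta>\<close>] by blast
  have "v (r powr \<delta>) = w (r powr \<delta>)"
    by (rule singular_ode.solution_unique[OF ode v(1,2) w(1,2)]) (use r in auto)
  then show ?thesis using v(3)[OF r] w(3)[OF r] by simp
qed

end

section \<open>Existence and uniqueness of the self-similar profile\<close>

theorem theorem1p1:
  fixes n :: nat and m \<rho>\<^sub>1 \<eta> \<alpha> \<beta> :: real
  assumes "n \<ge> 3"
    and "0 < m" and "m < (real n - 2) / real n"
    and "\<rho>\<^sub>1 > 0" and "\<eta> > 0"
    and "\<beta> > m * \<rho>\<^sub>1 / (real n - 2 - real n * m)"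
    and "\<alpha> = (2 * \<beta> + \<rho>\<^sub>1) / (1 - m)"
  shows "\<exists>!f. f \<in> extensional {0<..} \<and> C2_on {0<..} f
           \<and> (\<forall>r>0. radial_eq n m \<alpha> \<beta> f r \<and> f r > 0)
           \<and> ((\<lambda>r. r powr (\<alpha> / \<beta>) * f r) \<longlongrightarrow> \<eta>) (at_right 0)"
proof -
  define N where "N = real n"
  define k where "k = \<alpha> / \<beta>"
  have N: "3 \<le> N" "m * N < N - 2" using assms(1,3) by (auto simp: N_def field_simps)
  have m1: "m < 1"
  proof (rule ccontr)
    assume "\<not> m < 1"
    then have "1 * N \<le> m * N" using N by (intro mult_right_mono) auto
    with N show False by simp
  qed
  have \<beta>N: "m * \<rho>\<^sub>1 < \<beta> * (N - 2 - N * m)"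
    using assms(6) N by (simp add: N_def field_simps)
  have "0 \<le> m * \<rho>\<^sub>1 / (real n - 2 - real n * m)"
    using assms(2,4) N by (intro divide_nonneg_pos) (auto simp: N_def field_simps)
  then have \<beta>: "0 < \<beta>" using assms(6) by linarith
  have \<alpha>: "\<alpha> * (1 - m) = 2 * \<beta> + \<rho>\<^sub>1" "0 < \<alpha>" using m1 \<beta> assms(4,7) by auto
  have \<delta>: "\<rho>\<^sub>1 / \<beta> = k - k * m - 2" using \<alpha>(1) \<beta> by (simp add: k_def field_simps)
  \<comment> \<open>the lower bound on \<open>\<beta>\<close> is equivalent to \<open>k < (n - 2) / m\<close>\<close>
  have "m * \<alpha> * (1 - m) \<le> \<beta> * (N - 2) * (1 - m)"
  proof -
    have "m * \<alpha> * (1 - m) = m * (2 * \<beta> + \<rho>\<^sub>1)" using \<alpha>(1) by (simp add: mult.assoc)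
    also have "\<dots> \<le> 2 * m * \<beta> + \<beta> * (N - 2 - N * m)" using \<beta>N by (simp add: distrib_left)
    also have "\<dots> = \<beta> * (N - 2) * (1 - m)" by (simp add: algebra_simps)
    finally show ?thesis .
  qed
  then have "m * \<alpha> \<le> \<beta> * (N - 2)" using m1 by simp
  then have mk: "m * k \<le> real n - 2" using \<beta> by (simp add: k_def N_def field_simps)
  interpret self_similar n m k "\<rho>\<^sub>1 / \<beta>" \<alpha> \<beta>
  proof
    show "0 < m" "0 < \<rho>\<^sub>1 / \<beta>" using assms(2,4) \<beta> by auto
    show "\<rho>\<^sub>1 / \<beta> = k - k * m - 2" by (rule \<delta>)
    show "\<alpha> = k * \<beta>" using \<beta> by (simp add: k_def)
  qed
  have k: "0 \<le> k" using \<alpha> \<beta> by (simp add: k_def)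
  note hyps = m1 \<beta> k mk \<open>\<eta> > 0\<close>
  have "\<exists>!f. f \<in> extensional {0<..} \<and> is_profile \<eta> f"
  proof (rule ex_ex1I[OF profile_exists[OF hyps]])
    fix f g
    assume "f \<in> extensional {0<..} \<and> is_profile \<eta> f" "g \<in> extensional {0<..} \<and> is_profile \<eta> g"
    then show "f = g" using profile_unique[OF hyps, of f g] by (auto intro: extensionalityI)
  qed
  then show ?thesis unfolding is_profile_def unfolding k_def .
qed

end
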